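(* Consider the quadratic program $\min_z \tfrac12 z^\top P z+q^\top z$ subject to $Hz-g\in\mathbb K$, $z\in\mathbb D$, with all data as in the context, let $T$ be the PIPG operator with parameters $\alpha,\beta>0$, and let $(z^\star,w^\star)$ be the fixed point of $T$. Suppose: (1) The solution $z^\star$ of the quadratic program satisfies the extended LICQ, and each set $\mathbb D_{ij}$ is either a second-order cone, or an affine subspace, or a set $\{x:\Phi_{ij}(x)\preceq 0\}$ with smooth convex component functions such that at every point $x_0\in\mathbb D_{ij}$ the gradients at $x_0$ of those components of $\Phi_{ij}$ that vanish at $x_0$ form a linearly independent (or empty) set. (2) The Jacobian of the projection $\pi_{\mathbb D}$, wherever it exists, is a symmetric matrix. (3) (Strict complementarity) $-(Pz^\star+q+H^\top w^\star)\in\operatorname{ri}N_{\mathbb D}(z^\star)$ and $Hz^\star-g\in\operatorname{ri}N_{\mathbb K^\circ}(w^\star)$. Then there is a neighborhood of $(z^\star,w^\star)$ on which the Jacobians $J_{\mathbb D}$ and $J_{\mathbb K^\circ}$ defining $J_T(z,w)$ exist, $I-J_T(z,w)$ is a smooth function of $(z,w)$, and $I-J_T(z,w)$ is nonsingular.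
   Context: Problem data. $z=(z_0,\dots,z_{N+1})\in\mathbb R^{n_z}$, $z_i=(z_{i1},\dots,z_{im_i})\in\mathbb R^{n_{z_i}}$, $z_{ij}\in\mathbb R^{n_{ij}}$. $P=\operatorname{blkdiag}(\rho_{ij}I_{n_{ij}})$ with all $\rho_{ij}>0$; $q\in\mathbb R^{n_z}$. $\mathbb D=\prod_{i=0}^{N+1}\prod_{j=1}^{m_i}\mathbb D_{ij}$ is nonempty, where $\mathbb D_{ij}=\{x\in\mathbb R^{n_{ij}}:\Phi_{ij}(x)\preceq0\}$ is convex and $\preceq$ is the componentwise order. $H\in\mathbb R^{n_w\times n_z}$ is block bidiagonal: block row $i\in\{0,\dots,N\}$ has $A_i\in\mathbb R^{n_i\times n_{z_i}}$ in block column $i$, $B_i\in\mathbb R^{n_i\times n_{z_{i+1}}}$ in block column $i+1$, and zeros elsewhere; $n_i=n_{E_i}+n_{I_i}$, the first $n_{E_i}$ rows of block $i$ being equality rows and the remaining $n_{I_i}$ inequality rows; $n_w=\sum_i n_i$; $g\in\mathbb R^{n_w}$. $\mathbb K=\prod_{i=0}^N(\{0\}^{n_{E_i}}\times\mathbb R_+^{n_{I_i}})$, $\mathbb K^\circ=\prod_{i=0}^N(\mathbb R^{n_{E_i}}\times\mathbb R_-^{n_{I_i}})$, with $\mathbb R_+$, $\mathbb R_-$ the nonnegative and nonpositive reals. $H_E$, $H_I$ denote the submatrices of $H$ of equality rows and inequality rows. Second-order cone: a set $\{(x,y)\in\mathbb R^{n}\times\mathbb R:\|x\|\le ty,\ y\ge0\}$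 with fixed $t\in\mathbb R_+$. Extended LICQ: with $z^\star$ the optimal solution of the quadratic program and $H_{A_I}$ the matrix of those rows of $H_I$ whose inequality constraint holds with equality at $z^\star$, one has $\operatorname{range}([H_E^\top,H_{A_I}^\top])\cap\operatorname{span}(N_{\mathbb D}(z^\star))=\{0\}$ and $[H_E^\top,H_{A_I}^\top]$ has full column rank. $N_C(x)$ is the normal cone of the convex set $C$ at $x\in C$, $\pi_C$ the Euclidean projection onto $C$, $\operatorname{ri}$ the relative interior. PIPG operator: $T(z,w)=(z^+,w^+)$ with $z^+=\pi_{\mathbb D}[z-\alpha(Pz+q+H^\top w)]$ and $w^+=\pi_{\mathbb K^\circ}[w+\beta(H(2z^+-z)-g)]$. $J_T(z,w)=\begin{pmatrix}J_{\mathbb D}(I-\alpha P)&-\alpha J_{\mathbb D}H^\top\\ \beta J_{\mathbb K^\circ}H(-I+2J_{\mathbb D}(I-\alpha P))&J_{\mathbb K^\circ}-2\alpha\beta J_{\mathbb K^\circ}HJ_{\mathbb D}H^\top\end{pmatrix}$, where $J_{\mathbb D}$ is the Jacobian of $\pi_{\mathbb D}$ at $z-\alpha(Pz+q+H^\top w)$ and $J_{\mathbb K^\circ}$ is the Jacobian of $\pi_{\mathbb K^\circ}$ at $w+\beta(H(2z^+-z)-g)$ (defined whenever both exist). *)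

theory Defs
  imports "HOL-Analysis.Analysis"
begin

section \<open>Smooth functions, gradients, normal cones\<close>

text \<open>Meant for open \<open>S\<close> and finite-dimensional domains, where \<open>ck_on k S f\<close> says that \<open>f\<close> is
  k times continuously differentiable on \<open>S\<close>; smooth means infinitely differentiable.\<close>

primrec ck_on :: "nat \<Rightarrow> 'a::real_normed_vector set \<Rightarrow> ('a \<Rightarrow> 'b::real_normed_vector) \<Rightarrow> bool" where
  "ck_on 0 S f \<longleftrightarrow> continuous_on S f"
| "ck_on (Suc k) S f \<longleftrightarrow> (\<forall>x\<in>S. f differentiable (at x)) \<and>
     (\<forall>v. ck_on k S (\<lambda>x. frechet_derivative f (at x) v))"

definition smooth_on :: "'a::real_normed_vector set \<Rightarrow> ('a \<Rightarrow> 'b::real_normed_vector) \<Rightarrow> bool" where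
  "smooth_on S f \<longleftrightarrow> (\<forall>k. ck_on k S f)"

definition gradient :: "(real^'n \<Rightarrow> real) \<Rightarrow> real^'n::finite \<Rightarrow> real^'n" where
  "gradient f x = (\<chi> c. frechet_derivative f (at x) (axis c 1))"

definition normal_cone :: "'a::real_inner set \<Rightarrow> 'a \<Rightarrow> 'a set" where
  "normal_cone C x = {v. \<forall>y\<in>C. v \<bullet> (y - x) \<le> 0}"


section \<open>Block structure of the primal variable\<close>

text \<open>The coordinates of the stacked vector \<open>z\<close> are the elements of the index type \<open>'z\<close>; a
  labelling \<open>zc\<close> gives each of them its position \<open>(i, j, k)\<close>, i.e. coordinate \<open>k\<close> (from 1 to
  \<open>n i j\<close>) of the subvector \<open>z\<^sub>i\<^sub>j\<close>. The space \<open>\<real>\<close>^\<open>(n i j)\<close>, whose dimension varies with the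
  block, is represented by the coordinate subspace \<open>block_space zc i j\<close>, and the subvector
  \<open>z\<^sub>i\<^sub>j\<close> by the vector \<open>block_part zc i j z\<close> of that subspace.\<close>

definition z_positions :: "nat \<Rightarrow> (nat \<Rightarrow> nat) \<Rightarrow> (nat \<Rightarrow> nat \<Rightarrow> nat) \<Rightarrow> (nat \<times> nat \<times> nat) set" where
  "z_positions N m n = (SIGMA i:{0..N+1}. SIGMA j:{1..m i}. {1..n i j})"

definition in_block :: "('z \<Rightarrow> nat \<times> nat \<times> nat) \<Rightarrow> nat \<Rightarrow> nat \<Rightarrow> 'z \<Rightarrow> bool" where
  "in_block zc i j c \<longleftrightarrow> fst (zc c) = i \<and> fst (snd (zc c)) = j"

definition block_space :: "('z::finite \<Rightarrow> nat \<times> nat \<times> nat) \<Rightarrow> nat \<Rightarrow> nat \<Rightarrow> (real^'z) set" where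
  "block_space zc i j = {x. \<forall>c. \<not> in_block zc i j c \<longrightarrow> x $ c = 0}"

definition block_part :: "('z::finite \<Rightarrow> nat \<times> nat \<times> nat) \<Rightarrow> nat \<Rightarrow> nat \<Rightarrow> real^'z \<Rightarrow> real^'z" where
  "block_part zc i j z = (\<chi> c. if in_block zc i j c then z $ c else 0)"

definition block_scalar_diag ::
    "('z::finite \<Rightarrow> nat \<times> nat \<times> nat) \<Rightarrow> (nat \<Rightarrow> nat \<Rightarrow> real) \<Rightarrow> real^'z^'z" where
  "block_scalar_diag zc \<rho> =
     (\<chi> c d. if c = d then \<rho> (fst (zc c)) (fst (snd (zc c))) else 0)"

text \<open>In the following definitions \<open>\<Phi> i j l\<close> is the \<open>l\<close>-th of the \<open>p i j\<close> components of the
  constraint map of block \<open>(i, j)\<close>; only its values on \<open>block_space zc i j\<close> are used.\<close>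

definition block_set :: "('z::finite \<Rightarrow> nat \<times> nat \<times> nat) \<Rightarrow> (nat \<Rightarrow> nat \<Rightarrow> nat) \<Rightarrow>
    (nat \<Rightarrow> nat \<Rightarrow> nat \<Rightarrow> real^'z \<Rightarrow> real) \<Rightarrow> nat \<Rightarrow> nat \<Rightarrow> (real^'z) set" where
  "block_set zc p \<Phi> i j = {x \<in> block_space zc i j. \<forall>l\<in>{1..p i j}. \<Phi> i j l x \<le> 0}"

definition product_set :: "nat \<Rightarrow> (nat \<Rightarrow> nat) \<Rightarrow> ('z::finite \<Rightarrow> nat \<times> nat \<times> nat) \<Rightarrow>
    (nat \<Rightarrow> nat \<Rightarrow> (real^'z) set) \<Rightarrow> (real^'z) set" where
  "product_set N m zc Dij =
     {z. \<forall>i\<in>{0..N+1}. \<forall>j\<in>{1..m i}. block_part zc i j z \<in> Dij i j}"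

text \<open>The scalar coordinate of the second-order cone is the last coordinate \<open>c\<close> of the block, so
  \<open>x - axis c (x $ c)\<close> is the vector part.\<close>

definition is_second_order_cone :: "('z::finite \<Rightarrow> nat \<times> nat \<times> nat) \<Rightarrow> (nat \<Rightarrow> nat \<Rightarrow> nat) \<Rightarrow>
    nat \<Rightarrow> nat \<Rightarrow> (real^'z) set \<Rightarrow> bool" where
  "is_second_order_cone zc n i j S \<longleftrightarrow>
     (\<exists>c t. zc c = (i, j, n i j) \<and> 0 \<le> t \<and>
        S = {x \<in> block_space zc i j. norm (x - axis c (x $ c)) \<le> t * x $ c \<and> 0 \<le> x $ c})"

text \<open>Smoothness and gradients on \<open>block_space zc i j\<close> are those of the composition with
  \<open>block_part zc i j\<close>, which is constant in the remaining coordinates. Linear independence is that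
  of the indexed family of active gradients, hence the injectivity requirement.\<close>

definition smooth_independent_constraints :: "('z::finite \<Rightarrow> nat \<times> nat \<times> nat) \<Rightarrow>
    (nat \<Rightarrow> nat \<Rightarrow> nat) \<Rightarrow> (nat \<Rightarrow> nat \<Rightarrow> nat \<Rightarrow> real^'z \<Rightarrow> real) \<Rightarrow> nat \<Rightarrow> nat \<Rightarrow> bool" where
  "smooth_independent_constraints zc p \<Phi> i j \<longleftrightarrow>
     (\<forall>l\<in>{1..p i j}. smooth_on UNIV (\<lambda>z. \<Phi> i j l (block_part zc i j z)) \<and>
        convex_on (block_space zc i j) (\<Phi> i j l)) \<and>
     (\<forall>x\<in>block_set zc p \<Phi> i j.
        let active = {l \<in> {1..p i j}. \<Phi> i j l x = 0};
            grad = (\<lambda>l. gradient (\<lambda>z. \<Phi> i j l (block_part zc i j z)) x)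
        in inj_on grad active \<and> independent (grad ` active))"


section \<open>Block structure of the constraints\<close>

text \<open>Likewise \<open>wc\<close> labels the rows of \<open>H\<close> by \<open>(i, r)\<close>, the \<open>r\<close>-th row (from 1 to
  \<open>nE i + nI i\<close>) of block \<open>i\<close>.\<close>

definition w_positions :: "nat \<Rightarrow> (nat \<Rightarrow> nat) \<Rightarrow> (nat \<Rightarrow> nat) \<Rightarrow> (nat \<times> nat) set" where
  "w_positions N nE nI = (SIGMA i:{0..N}. {1..nE i + nI i})"

definition eq_rows :: "('w \<Rightarrow> nat \<times> nat) \<Rightarrow> (nat \<Rightarrow> nat) \<Rightarrow> 'w set" where
  "eq_rows wc nE = {r. snd (wc r) \<le> nE (fst (wc r))}"

text \<open>The entries in block positions \<open>(i, i)\<close> and \<open>(i, i + 1)\<close> are the matrices \<open>A\<^sub>i\<close>, \<open>B\<^sub>i\<close>.\<close>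

definition block_bidiagonal ::
    "('z::finite \<Rightarrow> nat \<times> nat \<times> nat) \<Rightarrow> ('w::finite \<Rightarrow> nat \<times> nat) \<Rightarrow> real^'z^'w \<Rightarrow> bool" where
  "block_bidiagonal zc wc H \<longleftrightarrow>
     (\<forall>r c. fst (zc c) \<noteq> fst (wc r) \<and> fst (zc c) \<noteq> fst (wc r) + 1 \<longrightarrow> H $ r $ c = 0)"

text \<open>The cone \<open>K\<close> and its polar, for the set \<open>E\<close> of equality rows.\<close>

definition cone_K :: "'w set \<Rightarrow> (real^'w::finite) set" where
  "cone_K E = {v. \<forall>r. if r \<in> E then v $ r = 0 else 0 \<le> v $ r}"

definition polar_K :: "'w set \<Rightarrow> (real^'w::finite) set" where
  "polar_K E = {v. \<forall>r. r \<notin> E \<longrightarrow> v $ r \<le> 0}"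

text \<open>The matrix whose columns are the rows of \<open>H\<close> in \<open>S\<close>, padded by zero columns; the padding
  changes neither range nor rank, so full column rank means rank \<open>card S\<close>.\<close>

definition selected_transpose :: "real^'z^'w \<Rightarrow> 'w set \<Rightarrow> real^'w::finite^'z::finite" where
  "selected_transpose H S = (\<chi> c r. if r \<in> S then H $ r $ c else 0)"

definition extended_LICQ :: "(real^'z) set \<Rightarrow> real^'z^'w::finite \<Rightarrow> real^'w \<Rightarrow> 'w set \<Rightarrow>
    real^'z::finite \<Rightarrow> bool" where
  "extended_LICQ D H g E z \<longleftrightarrow>
     (let S = E \<union> {r. r \<notin> E \<and> (H *v z) $ r = g $ r};
          M = selected_transpose H S
      in range (\<lambda>v. M *v v) \<inter> span (normal_cone D z) = {0} \<and> rank M = card S)"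


section \<open>The quadratic program and the PIPG operator\<close>

definition qp_solution :: "real^'z^'z \<Rightarrow> real^'z \<Rightarrow> real^'z^'w::finite \<Rightarrow> real^'w \<Rightarrow>
    (real^'w) set \<Rightarrow> (real^'z) set \<Rightarrow> real^'z::finite \<Rightarrow> bool" where
  "qp_solution P q H g K D z \<longleftrightarrow>
     is_arg_min (\<lambda>z. (1/2) * (z \<bullet> (P *v z)) + q \<bullet> z) (\<lambda>z. H *v z - g \<in> K \<and> z \<in> D) z"

definition primal_arg :: "real \<Rightarrow> real^'z^'z \<Rightarrow> real^'z \<Rightarrow> real^'z^'w::finite \<Rightarrow>
    real^'z \<Rightarrow> real^'w \<Rightarrow> real^'z::finite" where
  "primal_arg \<alpha> P q H z w = z - \<alpha> *\<^sub>R (P *v z + q + transpose H *v w)"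

definition primal_step :: "real \<Rightarrow> real^'z^'z \<Rightarrow> real^'z \<Rightarrow> real^'z^'w::finite \<Rightarrow> (real^'z) set \<Rightarrow>
    real^'z \<Rightarrow> real^'w \<Rightarrow> real^'z::finite" where
  "primal_step \<alpha> P q H D z w = closest_point D (primal_arg \<alpha> P q H z w)"

definition dual_arg :: "real \<Rightarrow> real \<Rightarrow> real^'z^'z \<Rightarrow> real^'z \<Rightarrow> real^'z^'w::finite \<Rightarrow> real^'w \<Rightarrow>
    (real^'z) set \<Rightarrow> real^'z::finite \<Rightarrow> real^'w \<Rightarrow> real^'w" where
  "dual_arg \<alpha> \<beta> P q H g D z w =
     w + \<beta> *\<^sub>R (H *v (2 *\<^sub>R primal_step \<alpha> P q H D z w - z) - g)"

definition pipg :: "real \<Rightarrow> real \<Rightarrow> real^'z^'z \<Rightarrow> real^'z \<Rightarrow> real^'z^'w::finite \<Rightarrow> real^'w \<Rightarrow>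
    (real^'z) set \<Rightarrow> (real^'w) set \<Rightarrow> (real^'z::finite) \<times> (real^'w) \<Rightarrow> (real^'z) \<times> (real^'w)" where
  "pipg \<alpha> \<beta> P q H g D Kpolar = (\<lambda>(z, w).
     (primal_step \<alpha> P q H D z w, closest_point Kpolar (dual_arg \<alpha> \<beta> P q H g D z w)))"

definition block_matrix :: "real^'z^'z \<Rightarrow> real^'w^'z \<Rightarrow> real^'z^'w \<Rightarrow> real^'w^'w \<Rightarrow>
    real^('z::finite + 'w::finite)^('z + 'w)" where
  "block_matrix A B C D = (\<chi> a b.
     case a of
       Inl r \<Rightarrow> (case b of Inl c \<Rightarrow> A $ r $ c | Inr c \<Rightarrow> B $ r $ c)
     | Inr r \<Rightarrow> (case b of Inl c \<Rightarrow> C $ r $ c | Inr c \<Rightarrow> D $ r $ c))"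

text \<open>Meaningful where both projections are differentiable at the respective arguments.\<close>

definition pipg_jacobian :: "real \<Rightarrow> real \<Rightarrow> real^'z^'z \<Rightarrow> real^'z \<Rightarrow> real^'z^'w::finite \<Rightarrow> real^'w \<Rightarrow>
    (real^'z) set \<Rightarrow> (real^'w) set \<Rightarrow> real^'z::finite \<Rightarrow> real^'w \<Rightarrow> real^('z + 'w)^('z + 'w)" where
  "pipg_jacobian \<alpha> \<beta> P q H g D Kpolar z w =
     (let JD = jacobian (closest_point D) (at (primal_arg \<alpha> P q H z w));
          JK = jacobian (closest_point Kpolar) (at (dual_arg \<alpha> \<beta> P q H g D z w))
      in block_matrix
           (JD ** (mat 1 - \<alpha> *\<^sub>R P))
           (- (\<alpha> *\<^sub>R (JD ** transpose H)))
           (\<beta> *\<^sub>R (JK ** H ** (- mat 1 + 2 *\<^sub>R (JD ** (mat 1 - \<alpha> *\<^sub>R P)))))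
           (JK - (2 * \<alpha> * \<beta>) *\<^sub>R (JK ** H ** JD ** transpose H)))"

end

theory Submission
  imports Defs
begin

text \<open>Strict complementarity makes the projection onto each block smooth near its argument, with the
  kernel of its derivative inside the span of the normal cone: if all small displacements orthogonal
  to the normal cone stay in the set, the projection is locally affine; otherwise the set is locally
  cut out by smooth convex functions with positive multipliers, and the inverse function theorem
  applies to the optimality system of the projection. At the fixed point, an element \<open>(x, u)\<close> of the
  kernel of \<open>I - J\<^sub>T\<close> satisfies \<open>u \<bullet> Hx = 0\<close>, so firm nonexpansiveness of the projection and
  positivity of \<open>P\<close> give \<open>x = 0\<close>; then \<open>H\<^sup>Tu\<close> lies in the span of the normal cone and the extended
  LICQ gives \<open>u = 0\<close>. Nonsingularity spreads to a neighborhood by continuity of the determinant.\<close>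

section \<open>Calculus of continuously differentiable functions\<close>

text \<open>The obstacle is the kernel of the primal Jacobian. Extended LICQ speaks only of the span
  of the normal cone, so smoothness of the projection does not suffice: every direction killed by
  its derivative must lie in that span. \<open>regular_projection\<close> packages both facts and
  passes to products over orthogonal blocks, so each kind of block set can be treated alone. A block
  set lives in a coordinate subspace; its cylinder, with all other coordinates free, carries the
  same information without extra equality constraints. The relative interior enters twice. In the
  flat case, small changes of the normal inside the span remain normals. In the curved case, the
  multipliers are strictly positive and stay so nearby, so the projection is described by equations
  alone. A second-order cone needs both cases, since its boundary is smooth only away from the apex.
  The dual cone is polyhedral, hence always flat: its Jacobian is locally constant and is the
  orthogonal projector along the span of its normals. This is the source of
  \<open>u \<bullet> Hx = 0\<close>.\<close>

lemma ck_on_subset: "ck_on k S f \<Longrightarrow> T \<subseteq> S \<Longrightarrow> ck_on k T f"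
  by (induction k arbitrary: f) (auto intro: continuous_on_subset)

lemma ck_on_SucD: "ck_on (Suc k) S f \<Longrightarrow> ck_on k S f"
proof (induction k arbitrary: f)
  case 0
  then show ?case
    by (auto intro!: differentiable_imp_continuous_on differentiable_at_imp_differentiable_on)
next
  case (Suc k)
  then show ?case by (metis ck_on.simps(2))
qed

lemma ck_on_has_derivative:
  assumes "ck_on (Suc k) S f" "x \<in> S"
  shows "(f has_derivative frechet_derivative f (at x)) (at x)"
  using assms by (simp add: frechet_derivative_works)

text \<open>Openness matters: a derivative at a point of \<open>S\<close> sees both functions on a
  neighborhood, which has to lie in \<open>S\<close>.\<close>

lemma ck_on_cong:
  assumes "ck_on k S f" "open S" "\<And>x. x \<in> S \<Longrightarrow> f x = g x"
  shows "ck_on k S g"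
  using assms
proof (induction k arbitrary: f g)
  case 0
  then show ?case by (simp cong: continuous_on_cong)
next
  case (Suc k)
  have der: "(g has_derivative frechet_derivative f (at x)) (at x)" if "x \<in> S" for x
    by (rule has_derivative_transform_within_open[OF ck_on_has_derivative])
      (use Suc.prems that in auto)
  then have eq: "frechet_derivative f (at x) = frechet_derivative g (at x)" if "x \<in> S" for x
    using that by (metis frechet_derivative_at)
  have "ck_on k S (\<lambda>x. frechet_derivative g (at x) v)" for v
    by (rule Suc.IH[of "\<lambda>x. frechet_derivative f (at x) v"]) (use Suc.prems eq in auto)
  then show ?case using der by (auto simp: differentiable_def)
qed

text \<open>Allows a derivative to be exhibited by formula; the closure rules below then recurse on
  that formula instead of on \<open>frechet_derivative\<close>.\<close>

lemma ck_on_SucI: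
  assumes "open S" "\<And>x. x \<in> S \<Longrightarrow> (f has_derivative f' x) (at x)"
    "\<And>v. ck_on k S (\<lambda>x. f' x v)"
  shows "ck_on (Suc k) S f"
proof -
  have "f' x = frechet_derivative f (at x)" if "x \<in> S" for x
    using assms(2)[OF that] by (metis frechet_derivative_at)
  then have "ck_on k S (\<lambda>x. frechet_derivative f (at x) v)" for v
    by (intro ck_on_cong[OF assms(3) assms(1), of v]) simp
  then show ?thesis
    using assms(2) by (auto simp: differentiable_def)
qed

lemma ck_on_const: "ck_on k S (\<lambda>x. c)"
  by (induction k arbitrary: c) (auto simp: frechet_derivative_const)

lemma ck_on_bounded_linear:
  assumes "bounded_linear h" "open S" "ck_on k S f"
  shows "ck_on k S (\<lambda>x. h (f x))"
  using assms(3)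
proof (induction k arbitrary: f)
  case 0
  then show ?case
    using assms(1) by (auto intro: bounded_linear.continuous_on)
next
  case (Suc k)
  show ?case
  proof (rule ck_on_SucI[OF \<open>open S\<close>])
    show "((\<lambda>x. h (f x)) has_derivative (\<lambda>v. h (frechet_derivative f (at x) v))) (at x)"
      if "x \<in> S" for x
      by (rule bounded_linear.has_derivative[OF assms(1) ck_on_has_derivative[OF Suc.prems that]])
    show "ck_on k S (\<lambda>x. h (frechet_derivative f (at x) v))" for v
      using Suc by simp
  qed
qed

lemma ck_on_ident: "open S \<Longrightarrow> ck_on k S (\<lambda>x. x)"
proof (cases k)
  case (Suc l)
  assume "open S"
  then show ?thesis
    unfolding Suc
    by (rule ck_on_SucI[where f' = "\<lambda>x v. v"]) (auto simp: ck_on_const)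
qed simp

lemma ck_on_linear: "bounded_linear h \<Longrightarrow> open S \<Longrightarrow> ck_on k S h"
  using ck_on_bounded_linear[OF _ _ ck_on_ident] by blast

lemma ck_on_add:
  assumes "open S" "ck_on k S f" "ck_on k S g"
  shows "ck_on k S (\<lambda>x. f x + g x)"
  using assms(2,3)
proof (induction k arbitrary: f g)
  case 0
  then show ?case by (auto intro: continuous_on_add)
next
  case (Suc k)
  show ?case
    by (rule ck_on_SucI[OF \<open>open S\<close> has_derivative_add[OF
          ck_on_has_derivative[OF Suc.prems(1)] ck_on_has_derivative[OF Suc.prems(2)]]])
      (use Suc in auto)
qed

lemma ck_on_minus: "open S \<Longrightarrow> ck_on k S f \<Longrightarrow> ck_on k S (\<lambda>x. - f x)"
  by (rule ck_on_bounded_linear[OF bounded_linear_minus[OF bounded_linear_ident]])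

lemma ck_on_diff:
  "open S \<Longrightarrow> ck_on k S f \<Longrightarrow> ck_on k S g \<Longrightarrow> ck_on k S (\<lambda>x. f x - g x)"
  using ck_on_add[of S k f "\<lambda>x. - g x"] by (simp add: ck_on_minus)

lemma ck_on_sum:
  assumes "open S" "\<And>i. i \<in> A \<Longrightarrow> ck_on k S (f i)"
  shows "ck_on k S (\<lambda>x. \<Sum>i\<in>A. f i x)"
  using assms(2)
  by (induction A rule: infinite_finite_induct) (auto simp: ck_on_const intro!: ck_on_add assms(1))

lemma ck_on_bilinear:
  assumes "bounded_bilinear h" "open S" "ck_on k S f" "ck_on k S g"
  shows "ck_on k S (\<lambda>x. h (f x) (g x))"
  using assms(3,4)
proof (induction k arbitrary: f g)
  case 0
  then show ?case using assms(1) by (auto intro: bounded_bilinear.continuous_on)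
next
  case (Suc k)
  let ?D = "\<lambda>f x. frechet_derivative f (at x)"
  show ?case
  proof (rule ck_on_SucI[OF \<open>open S\<close> bounded_bilinear.FDERIV[OF assms(1)
          ck_on_has_derivative[OF Suc.prems(1)] ck_on_has_derivative[OF Suc.prems(2)]]])
    show "ck_on k S (\<lambda>x. h (f x) (?D g x v) + h (?D f x v) (g x))" for v
      using Suc.prems Suc.prems[THEN ck_on_SucD]
      by (intro ck_on_add Suc.IH assms(2)) simp_all
  qed
qed

lemmas ck_on_mult = ck_on_bilinear[OF bounded_bilinear_mult]
lemmas ck_on_scaleR = ck_on_bilinear[OF bounded_bilinear_scaleR]
lemmas ck_on_inner = ck_on_bilinear[OF bounded_bilinear_inner]

lemma ck_on_prod:
  fixes f :: "'i \<Rightarrow> 'a::real_normed_vector \<Rightarrow> real"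
  assumes "open S" "\<And>i. i \<in> A \<Longrightarrow> ck_on k S (f i)"
  shows "ck_on k S (\<lambda>x. \<Prod>i\<in>A. f i x)"
  using assms(2)
  by (induction A rule: infinite_finite_induct) (auto simp: ck_on_const intro!: ck_on_mult assms(1))

text \<open>The derivative is built from \<open>f\<close>, its derivative and the reciprocal itself,
  so each order follows from the previous one.\<close>

lemma ck_on_inverse:
  fixes f :: "'a::real_normed_vector \<Rightarrow> real"
  assumes "open S" "ck_on k S f" "\<And>x. x \<in> S \<Longrightarrow> f x \<noteq> 0"
  shows "ck_on k S (\<lambda>x. inverse (f x))"
  using assms(2)
proof (induction k)
  case 0
  then show ?case using assms(3) by (auto intro: continuous_on_inverse)
next
  case (Suc k)
  show ?case
    by (rule ck_on_SucI[OF assms(1) Deriv.has_derivative_inverse[OF assms(3)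
            ck_on_has_derivative[OF Suc.prems]]])
      (use Suc Suc.prems[THEN ck_on_SucD] in \<open>auto intro!: ck_on_minus ck_on_mult assms(1)\<close>)
qed

lemma ck_on_norm:
  fixes S :: "'a::real_inner set"
  assumes "open S" "0 \<notin> S"
  shows "ck_on k S norm"
proof (induction k)
  case 0
  then show ?case by (simp add: continuous_on_norm_id)
next
  case (Suc k)
  show ?case
  proof (rule ck_on_SucI[OF assms(1)])
    show "(norm has_derivative (\<lambda>h. (x \<bullet> h) * inverse (norm x))) (at x)" if "x \<in> S" for x
      using has_derivative_norm[of x] that assms(2)
      by (auto simp: sgn_div_norm inner_commute mult.commute)
    show "ck_on k S (\<lambda>x. (x \<bullet> h) * inverse (norm x))" for h
      using assms Suc by (auto intro!: ck_on_mult ck_on_inner ck_on_inverse ck_on_ident ck_on_const)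
  qed
qed

text \<open>In the chain rule the derivative of \<open>g\<close> is applied to a direction that
  varies with the point, while the induction hypothesis covers fixed directions only. Expanding that
  direction in the basis of the middle space separates the two dependencies.\<close>

lemma ck_on_compose:
  fixes f :: "'a::real_normed_vector \<Rightarrow> 'b::euclidean_space"
  assumes "open S" "f ` S \<subseteq> T" "ck_on k S f" "ck_on k T g"
  shows "ck_on k S (\<lambda>x. g (f x))"
  using assms(3,4)
proof (induction k arbitrary: g)
  case 0
  then show ?case using assms(2) by (auto intro: continuous_on_compose2)
next
  case (Suc k)
  let ?Dg = "\<lambda>x b. frechet_derivative g (at (f x)) b"
  let ?Df = "\<lambda>x v. frechet_derivative f (at x) v"
  show ?case
  proof (rule ck_on_SucI[OF assms(1)])
    fix x assume x: "x \<in> S"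
    have g: "(g has_derivative ?Dg x) (at (f x))"
      by (rule ck_on_has_derivative[OF Suc.prems(2)]) (use assms(2) x in auto)
    then have lin: "linear (?Dg x)" by (rule has_derivative_linear)
    have "(\<Sum>b\<in>Basis. (w \<bullet> b) *\<^sub>R ?Dg x b) = ?Dg x w" for w
    proof -
      have "?Dg x w = ?Dg x (\<Sum>b\<in>Basis. (w \<bullet> b) *\<^sub>R b)"
        by (simp add: euclidean_representation)
      also have "\<dots> = (\<Sum>b\<in>Basis. (w \<bullet> b) *\<^sub>R ?Dg x b)"
        by (simp add: linear_sum[OF lin] linear_cmul[OF lin])
      finally show ?thesis by simp
    qed
    moreover have "((\<lambda>x. g (f x)) has_derivative (\<lambda>v. ?Dg x (?Df x v))) (at x)"
      using diff_chain_at[OF ck_on_has_derivative[OF Suc.prems(1) x] g] by (simp add: o_def)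
    ultimately show "((\<lambda>x. g (f x)) has_derivative
        (\<lambda>v. \<Sum>b\<in>Basis. (?Df x v \<bullet> b) *\<^sub>R ?Dg x b)) (at x)"
      by simp
  next
    fix v
    have "ck_on k S (\<lambda>x. ?Dg x b)" for b
      using Suc.IH[of "\<lambda>y. frechet_derivative g (at y) b"] Suc.prems by (simp add: ck_on_SucD)
    then show "ck_on k S (\<lambda>x. \<Sum>b\<in>Basis. (?Df x v \<bullet> b) *\<^sub>R ?Dg x b)"
      using Suc.prems by (intro ck_on_sum ck_on_scaleR ck_on_inner assms(1) ck_on_const) auto
  qed
qed

lemma ck_on_vec:
  fixes f :: "'i::finite \<Rightarrow> 'a::real_normed_vector \<Rightarrow> 'b::euclidean_space"
  assumes "open S" "\<And>i. ck_on k S (f i)"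
  shows "ck_on k S (\<lambda>x. \<chi> i. f i x)"
proof -
  have "bounded_linear (axis i :: 'b \<Rightarrow> 'b^'i)" for i
    unfolding linear_conv_bounded_linear[symmetric]
    by (rule linearI) (auto simp: axis_def vec_eq_iff)
  then have "ck_on k S (\<lambda>x. \<Sum>i\<in>UNIV. axis i (f i x))"
    by (intro ck_on_sum[OF assms(1)] ck_on_bounded_linear[OF _ assms(1) assms(2)])
  moreover have "(\<lambda>x. \<Sum>i\<in>UNIV. axis i (f i x)) = (\<lambda>x. \<chi> i. f i x)"
  proof
    fix x
    show "(\<Sum>i\<in>UNIV. axis i (f i x)) = (\<chi> i. f i x)"
      by (simp add: vec_eq_iff axis_def)
  qed
  ultimately show ?thesis by simp
qed

lemma ck_on_nth:
  fixes f :: "'a::real_normed_vector \<Rightarrow> 'b::real_normed_vector^'i::finite"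
  shows "open S \<Longrightarrow> ck_on k S f \<Longrightarrow> ck_on k S (\<lambda>x. f x $ i)"
  by (rule ck_on_bounded_linear[OF bounded_linear_vec_nth])

lemma ck_on_det:
  fixes A :: "'a::real_normed_vector \<Rightarrow> real^'n^'n::finite"
  assumes "open S" "\<And>i j. ck_on k S (\<lambda>x. A x $ i $ j)"
  shows "ck_on k S (\<lambda>x. det (A x))"
  unfolding det_def using assms by (intro ck_on_sum ck_on_mult ck_on_prod ck_on_const)

lemma ck_on_jacobian:
  fixes f :: "real^'n::finite \<Rightarrow> real^'m::finite"
  assumes "open S" "ck_on (Suc k) S f"
  shows "ck_on k S (\<lambda>x. jacobian f (at x))"
  unfolding jacobian_def matrix_def using assms by (intro ck_on_vec ck_on_nth) auto

lemma smooth_on_ck: "smooth_on S f \<Longrightarrow> ck_on k S f"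
  by (simp add: smooth_on_def)

lemma smooth_on_differentiable: "smooth_on S f \<Longrightarrow> x \<in> S \<Longrightarrow> f differentiable (at x)"
  using smooth_on_ck[of S f 1] by simp

lemma smooth_on_derivative: "smooth_on S f \<Longrightarrow> smooth_on S (\<lambda>x. frechet_derivative f (at x) v)"
  unfolding smooth_on_def using ck_on.simps(2) by blast

lemma smooth_on_continuous: "smooth_on S f \<Longrightarrow> continuous_on S f"
  using smooth_on_ck[of S f 0] by simp

lemma smooth_on_subset: "smooth_on S f \<Longrightarrow> T \<subseteq> S \<Longrightarrow> smooth_on T f"
  unfolding smooth_on_def using ck_on_subset by blast

lemma smooth_on_jacobian:
  fixes f :: "real^'n::finite \<Rightarrow> real^'m::finite"
  shows "open S \<Longrightarrow> smooth_on S f \<Longrightarrow> smooth_on S (\<lambda>x. jacobian f (at x))"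
  unfolding smooth_on_def by (auto intro!: ck_on_jacobian)

section \<open>Smooth inverse function theorem\<close>

lemma matrix_inverse_by_cramer:
  fixes A :: "real^'n^'n::finite"
  assumes "det A \<noteq> 0" "A *v x = b"
  shows "x = (\<chi> k. det (\<chi> i j. if j = k then b $ i else A $ i $ j) * inverse (det A))"
  using cramer[OF assms(1), of x b] assms(2) by (simp add: divide_inverse)

text \<open>By Cramer's rule the derivative of the inverse is a rational expression in the entries of the
  Jacobian, so smoothness is gained one order at a time.\<close>

lemma ck_on_local_inverse:
  fixes F :: "real^'n \<Rightarrow> real^'n::finite"
  assumes T: "open T" and F: "smooth_on S F" and gS: "g ` T \<subseteq> S"
    and g: "\<And>y. y \<in> T \<Longrightarrow> (g has_derivative g' y) (at y)"
    and inv: "\<And>y v. y \<in> T \<Longrightarrow> frechet_derivative F (at (g y)) (g' y v) = v"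
    and det: "\<And>y. y \<in> T \<Longrightarrow> det (jacobian F (at (g y))) \<noteq> 0"
    and S: "open S"
  shows "ck_on k T g"
proof (induction k)
  case 0
  show ?case
    using has_derivative_continuous[OF g] by (simp add: continuous_at_imp_continuous_on)
next
  case (Suc k)
  let ?A = "\<lambda>y. jacobian F (at (g y))"
  show ?case
  proof (rule ck_on_SucI[OF T])
    fix y assume y: "y \<in> T"
    have "?A y *v g' y v = v" for v
    proof -
      have "F differentiable (at (g y))"
        using F gS y by (auto intro: smooth_on_differentiable)
      then have "frechet_derivative F (at (g y)) = (\<lambda>h. ?A y *v h)"
        by (metis jacobian_works frechet_derivative_at)
      then show ?thesis using inv[OF y] by metis
    qed
    then have "g' y v = (\<chi> k. det (\<chi> i j. if j = k then v $ i else ?A y $ i $ j) * inverse (det (?A y)))"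
      for v using matrix_inverse_by_cramer[OF det[OF y]] by blast
    then show "(g has_derivative (\<lambda>v. \<chi> k. det (\<chi> i j. if j = k then v $ i else ?A y $ i $ j)
        * inverse (det (?A y)))) (at y)"
      using g[OF y] by presburger
  next
    fix v
    have "ck_on k T ?A"
      by (rule ck_on_compose[OF T gS Suc])
        (use smooth_on_jacobian[OF S F] in \<open>simp add: smooth_on_def\<close>)
    then have A: "ck_on k T (\<lambda>y. ?A y $ i $ j)" for i j
      by (intro ck_on_nth T)
    have "ck_on k T (\<lambda>y. if j = l then v $ i else ?A y $ i $ j)" for i j l
      using A[of i j] by (cases "j = l") (auto simp: ck_on_const)
    then show "ck_on k T (\<lambda>y. \<chi> l. det (\<chi> i j. if j = l then v $ i else ?A y $ i $ j)
        * inverse (det (?A y)))"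
      by (intro ck_on_vec ck_on_mult ck_on_inverse ck_on_det T A) (auto simp: det)
  qed
qed

theorem smooth_local_inverse:
  fixes F :: "real^'n \<Rightarrow> real^'n::finite"
  assumes S: "open S" "x0 \<in> S" and F: "smooth_on S F"
    and inj: "\<And>h. frechet_derivative F (at x0) h = 0 \<Longrightarrow> h = 0"
  obtains V g where "open V" "F x0 \<in> V" "smooth_on V g" "g (F x0) = x0"
    "\<And>y. y \<in> V \<Longrightarrow> g y \<in> S \<and> F (g y) = y"
    "\<And>v. frechet_derivative F (at x0) (frechet_derivative g (at (F x0)) v) = v"
proof -
  let ?J = "\<lambda>x. jacobian F (at x)"
  let ?D = "\<lambda>x. frechet_derivative F (at x)"
  \<comment> \<open>On \<open>S'\<close> the derivative is invertible at every point, not only at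
    \<open>x0\<close>; the formula for the derivative of the inverse is needed on all of
    \<open>V\<close>.\<close>
  define S' where "S' = {x \<in> S. det (?J x) \<noteq> 0}"
  have der: "(F has_derivative ?D x) (at x)" if "x \<in> S" for x
    using smooth_on_differentiable[OF F that] by (simp add: frechet_derivative_works)
  have fr: "?D x = (\<lambda>h. ?J x *v h)" if "x \<in> S" for x
    using smooth_on_differentiable[OF F that] by (metis jacobian_works frechet_derivative_at)
  have "ck_on 0 S ?J"
    using smooth_on_jacobian[OF S(1) F] unfolding smooth_on_def by blast
  then have "ck_on 0 S (\<lambda>x. det (?J x))"
    by (intro ck_on_det ck_on_nth S)
  then have "open S'"
  proof -
    assume "ck_on 0 S (\<lambda>x. det (?J x))"
    then have "open (S \<inter> (\<lambda>x. det (?J x)) -` (- {0}))"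
      using S(1) by (intro continuous_open_preimage) auto
    moreover have "S' = S \<inter> (\<lambda>x. det (?J x)) -` (- {0})"
      by (auto simp: S'_def)
    ultimately show ?thesis by simp
  qed
  have "inj (\<lambda>h. ?J x0 *v h)"
    using inj[unfolded fr[OF S(2)]] by (simp add: vec.inj_iff_eq_0)
  then have det0: "det (?J x0) \<noteq> 0"
    using det_nz_iff_inj[of "\<lambda>h. ?J x0 *v h"] by simp
  then have "x0 \<in> S'" using S by (simp add: S'_def)
  define f' where "f' x = Blinfun (?D x)" for x
  have f': "blinfun_apply (f' x) = ?D x" if "x \<in> S" for x
    unfolding f'_def using der[OF that] by (intro bounded_linear_Blinfun_apply has_derivative_bounded_linear)
  have bij: "bij (?D x)" if "x \<in> S'" for x
  proof -
    have x: "x \<in> S" "det (?J x) \<noteq> 0" using that by (auto simp: S'_def)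
    then have "inj (\<lambda>h. ?J x *v h)"
      using det_nz_iff_inj[of "\<lambda>h. ?J x *v h"] by simp
    then show ?thesis
      using x fr by (simp add: bij_def linear_injective_imp_surjective)
  qed
  define invf where "invf = Blinfun (inv (?D x0))"
  have lin0: "linear (?D x0)" using der[OF S(2)] by (rule has_derivative_linear)
  have "linear (inv (?D x0))"
    by (rule inj_linear_imp_inv_linear[OF lin0 bij_is_inj[OF bij[OF \<open>x0 \<in> S'\<close>]]])
  then have "blinfun_apply invf = inv (?D x0)"
    unfolding invf_def by (intro bounded_linear_Blinfun_apply) (simp add: linear_conv_bounded_linear)
  then have invf: "invf o\<^sub>L f' x0 = id_blinfun"
    using bij[OF \<open>x0 \<in> S'\<close>] by (intro blinfun_eqI) (simp add: f' S bij_is_inj)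
  \<comment> \<open>Continuity is required in operator norm; in finite dimension it follows from
    continuity on each fixed vector.\<close>
  have contf': "continuous_on S' f'"
  proof (rule continuous_on_blinfun_componentwise)
    fix b :: "real^'n"
    have "continuous_on S (\<lambda>x. ?D x b)"
      using smooth_on_continuous[OF smooth_on_derivative[OF F]] .
    then have "continuous_on S' (\<lambda>x. ?D x b)"
      by (rule continuous_on_subset) (auto simp: S'_def)
    then show "continuous_on S' (\<lambda>x. blinfun_apply (f' x) b)"
      by (rule continuous_on_eq) (auto simp: f' S'_def)
  qed
  have derS': "(F has_derivative blinfun_apply (f' x)) (at x)" if "x \<in> S'" for x
    using der f' that by (auto simp: S'_def)
  obtain U V g g' where U: "open U" "U \<subseteq> S'" "x0 \<in> U" and V: "open V" "F x0 \<in> V"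
    and hom: "homeomorphism U V F g"
    and g: "\<And>y. y \<in> V \<Longrightarrow> (g has_derivative (g' y)) (at y)"
    and g': "\<And>y. y \<in> V \<Longrightarrow> g' y = inv (blinfun_apply (f' (g y)))"
    by (rule inverse_function_theorem[OF \<open>open S'\<close> derS' contf' \<open>x0 \<in> S'\<close> invf]) auto
  have gV: "g y \<in> S'" "F (g y) = y" if "y \<in> V" for y
    using hom U(2) that by (auto simp: homeomorphism_def)
  have g0: "g (F x0) = x0" using hom U(3) by (auto simp: homeomorphism_def)
  have inv: "?D (g y) (g' y v) = v" if "y \<in> V" for y v
    using bij[OF gV(1)[OF that]] g'[OF that] f' gV(1)[OF that]
    by (simp add: S'_def bij_is_surj surj_f_inv_f)
  show ?thesis
  proof
    show "smooth_on V g"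
      unfolding smooth_on_def
      using ck_on_local_inverse[OF V(1) F _ g inv _ S(1)] gV by (auto simp: S'_def)
    show "g y \<in> S \<and> F (g y) = y" if "y \<in> V" for y
      using gV that by (auto simp: S'_def)
    show "?D x0 (frechet_derivative g (at (F x0)) v) = v" for v
      using inv[OF V(2)] g0 frechet_derivative_at[OF g[OF V(2)]] by simp
  qed (use V g0 in auto)
qed

section \<open>Normal cones and projections\<close>

lemma normal_cone_zero: "0 \<in> normal_cone C x"
  by (simp add: normal_cone_def)

lemma normal_cone_add: "u \<in> normal_cone C x \<Longrightarrow> v \<in> normal_cone C x \<Longrightarrow> u + v \<in> normal_cone C x"
  by (fastforce simp: normal_cone_def inner_add_left)

lemma normal_cone_scale: "u \<in> normal_cone C x \<Longrightarrow> 0 \<le> c \<Longrightarrow> c *\<^sub>R u \<in> normal_cone C x"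
  by (auto simp: normal_cone_def mult_nonneg_nonpos)

lemma normal_cone_sum:
  "(\<And>i. i \<in> A \<Longrightarrow> f i \<in> normal_cone C x) \<Longrightarrow> (\<Sum>i\<in>A. f i) \<in> normal_cone C x"
  by (induction A rule: infinite_finite_induct) (auto simp: normal_cone_zero normal_cone_add)

lemma convex_normal_cone: "convex (normal_cone C x)"
  by (intro convexI normal_cone_add normal_cone_scale) auto

lemma affine_hull_normal_cone: "affine hull (normal_cone C x) = span (normal_cone C x)"
  by (simp add: affine_hull_span_0 hull_inc normal_cone_zero)

text \<open>The obtuse-angle criterion: in the expansion of the squared distance the cross term is
  nonnegative. This direction lets a projection be identified by guessing it and checking the
  residual.\<close>

lemma closest_point_normal_cone:
  assumes "convex C" "closed C" "x \<in> C" "y - x \<in> normal_cone C x"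
  shows "closest_point C y = x"
proof (rule closest_point_unique[OF assms(1-3), symmetric], rule ballI)
  fix c assume "c \<in> C"
  then have "(y - x) \<bullet> (c - x) \<le> 0"
    using assms(4) by (simp add: normal_cone_def)
  moreover have "(dist y c)\<^sup>2 = (dist y x)\<^sup>2 + (norm (c - x))\<^sup>2 - 2 * ((y - x) \<bullet> (c - x))"
    by (simp add: dist_norm power2_norm_eq_inner algebra_simps inner_commute)
  ultimately have "(dist y x)\<^sup>2 \<le> (dist y c)\<^sup>2"
    using zero_le_power2[of "norm (c - x)"] by linarith
  then show "dist y x \<le> dist y c" by (rule power2_le_imp_le) simp
qed

lemma diff_closest_point_normal_cone:
  assumes "convex C" "closed C"
  shows "y - closest_point C y \<in> normal_cone C (closest_point C y)"
  using closest_point_dot[OF assms] by (simp add: normal_cone_def)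

text \<open>A positive multiple maps the cone onto itself, hence also its relative interior. This
  turns strict complementarity into a statement about the displacements scaled by the step
  sizes.\<close>

lemma rel_interior_normal_cone_scale:
  fixes C :: "'a::euclidean_space set"
  assumes "v \<in> rel_interior (normal_cone C x)" "0 < c"
  shows "c *\<^sub>R v \<in> rel_interior (normal_cone C x)"
proof -
  have "u \<in> (*\<^sub>R) c ` normal_cone C x" if "u \<in> normal_cone C x" for u
    using normal_cone_scale[OF that, of "inverse c"] assms(2)
    by (intro image_eqI[of _ _ "inverse c *\<^sub>R u"]) auto
  then have "(*\<^sub>R) c ` normal_cone C x = normal_cone C x"
    using assms(2) by (auto intro: normal_cone_scale)
  then show ?thesis
    using rel_interior_scaleR[of c "normal_cone C x"] assms by force
qed

text \<open>\<open>pr\<close> projects onto the orthogonal complement of \<open>W\<close>. The two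
  norm bounds come from Pythagoras and keep both parts of a small displacement small.\<close>

lemma orthogonal_projection_exists:
  fixes W :: "'a::euclidean_space set"
  assumes "subspace W"
  obtains pr where "linear pr" "\<And>x. x - pr x \<in> W" "\<And>x w. w \<in> W \<Longrightarrow> pr x \<bullet> w = 0"
    "\<And>w. w \<in> W \<Longrightarrow> pr w = 0" "\<And>x. norm (pr x) \<le> norm x" "\<And>x. norm (x - pr x) \<le> norm x"
proof -
  obtain B where B: "B \<subseteq> W" "pairwise orthogonal B" "\<And>x. x \<in> B \<Longrightarrow> norm x = 1"
    "independent B" "span B = W"
    using orthonormal_basis_subspace[OF assms] by metis
  have fin: "finite B" using B(4) by (rule independent_imp_finite)
  define pr where "pr x = x - (\<Sum>b\<in>B. (x \<bullet> b) *\<^sub>R b)" for x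
  have diff: "x - pr x \<in> W" for x
    unfolding pr_def using B by (auto intro!: subspace_sum subspace_scale assms)
  have orth: "pr x \<bullet> b = 0" if b: "b \<in> B" for x b
  proof -
    have "(\<Sum>a\<in>B. (x \<bullet> a) *\<^sub>R a) \<bullet> b = (\<Sum>a\<in>B. if a = b then x \<bullet> b else 0)"
      unfolding inner_sum_left
    proof (intro sum.cong refl)
      fix a assume "a \<in> B"
      then show "(x \<bullet> a) *\<^sub>R a \<bullet> b = (if a = b then x \<bullet> b else 0)"
        using B(2,3) b by (auto simp: pairwise_def orthogonal_def norm_eq_1)
    qed
    also have "\<dots> = x \<bullet> b" using b fin by simp
    finally show ?thesis by (simp add: pr_def inner_diff_left)
  qed
  have orthW: "pr x \<bullet> w = 0" if "w \<in> W" for x w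
    using that orthogonal_to_span[of w B "pr x"] orth B(5)
    by (auto simp: orthogonal_def inner_commute)
  have pyth: "(norm x)\<^sup>2 = (norm (pr x))\<^sup>2 + (norm (x - pr x))\<^sup>2" for x
    using orthW[OF diff[of x], of x] by (simp add: power2_norm_eq_inner algebra_simps inner_commute)
  show ?thesis
  proof
    show "linear pr"
      unfolding pr_def
      by (rule linearI) (simp_all add: inner_add_left scaleR_add_left sum.distrib algebra_simps
          scaleR_sum_right)
    show "pr w = 0" if "w \<in> W" for w
    proof -
      have "pr w \<in> W" using diff[of w] that assms by (metis diff_diff_eq2 add_diff_cancel_left' subspace_diff)
      then show ?thesis using orthW[of "pr w" w] by simp
    qed
    show "norm (pr x) \<le> norm x" "norm (x - pr x) \<le> norm x" for x
      using pyth[of x] by (auto intro: power2_le_imp_le)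
  qed (use diff orthW in auto)
qed

text \<open>In its uses \<open>v\<close> is a normal at \<open>z\<close>, so that
  \<open>z + v\<close> is a point projected to \<open>z\<close>. The kernel condition is the form in
  which the geometry of the set meets the extended LICQ.\<close>

definition regular_projection :: "(real^'n::finite) set \<Rightarrow> real^'n \<Rightarrow> real^'n \<Rightarrow> bool" where
  "regular_projection C z v \<longleftrightarrow>
     (\<exists>V. open V \<and> z + v \<in> V \<and> smooth_on V (closest_point C)) \<and>
     (\<forall>d. frechet_derivative (closest_point C) (at (z + v)) d = 0 \<longrightarrow> d \<in> span (normal_cone C z))"

text \<open>Split a small displacement \<open>h\<close> of the argument into \<open>pr h\<close>,
  orthogonal to all normals, and the rest, which lies in their span. The first part moves
  \<open>z\<close> inside \<open>C\<close>; the second only changes the normal, which stays a normal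
  because \<open>v\<close> is relatively interior. Hence the projection moves exactly by
  \<open>pr h\<close>.\<close>

lemma projection_on_flat_face:
  fixes C :: "'a::euclidean_space set"
  assumes C: "convex C" "closed C" and z: "z \<in> C"
    and v: "v \<in> rel_interior (normal_cone C z)"
    and e: "0 < e"
    and flat: "\<And>w. (\<And>u. u \<in> normal_cone C z \<Longrightarrow> w \<bullet> u = 0) \<Longrightarrow> norm w < e \<Longrightarrow> z + w \<in> C"
  obtains V pr where "open V" "z + v \<in> V" "linear pr"
    "\<And>y. y \<in> V \<Longrightarrow> closest_point C y = z + pr (y - z)"
    "\<And>x. x - pr x \<in> span (normal_cone C z)"
    "\<And>x u. u \<in> span (normal_cone C z) \<Longrightarrow> pr x \<bullet> u = 0"
proof -
  let ?N = "normal_cone C z"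
  obtain pr where lin: "linear pr" and pr: "\<And>x. x - pr x \<in> span ?N"
      "\<And>x w. w \<in> span ?N \<Longrightarrow> pr x \<bullet> w = 0" "\<And>w. w \<in> span ?N \<Longrightarrow> pr w = 0"
      "\<And>x. norm (pr x) \<le> norm x" "\<And>x. norm (x - pr x) \<le> norm x"
    using orthogonal_projection_exists[OF subspace_span] by metis
  obtain r where r: "r > 0" "ball v r \<inter> span ?N \<subseteq> ?N" and vN: "v \<in> ?N"
    using v unfolding mem_rel_interior_ball affine_hull_normal_cone by blast
  \<comment> \<open>Radius \<open>e\<close> keeps the moved point in \<open>C\<close>; radius
    \<open>r\<close> keeps the moved normal in the normal cone.\<close>
  show ?thesis
  proof (rule that[of "ball (z + v) (min e r)" pr])
    fix y assume y: "y \<in> ball (z + v) (min e r)"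
    define h where "h = y - (z + v)"
    have h: "norm h < e" "norm h < r"
      using y by (auto simp: h_def dist_norm norm_minus_commute)
    have prv: "pr v = 0" using vN by (intro pr span_base)
    have eq: "pr (y - z) = pr h"
      using linear_add[OF lin, of h v] prv by (simp add: h_def)
    have mem: "z + pr h \<in> C"
      using flat[of "pr h"] pr(2)[of _ h] pr(4)[of h] h(1) by (auto simp: span_base)
    have "v + (h - pr h) \<in> span ?N"
      using vN pr(1) by (intro span_add) (auto simp: span_base)
    moreover have "v + (h - pr h) \<in> ball v r"
      using pr(5)[of h] h(2) by (simp add: dist_norm norm_minus_commute)
    ultimately have N: "v + (h - pr h) \<in> ?N" using r(2) by blast
    \<comment> \<open>A normal at \<open>z\<close> remains one at \<open>z + pr h\<close>, since it
      is orthogonal to \<open>pr h\<close>.\<close>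
    have "v + (h - pr h) \<in> normal_cone C (z + pr h)"
      unfolding normal_cone_def
    proof (safe)
      fix c assume "c \<in> C"
      then have "(v + (h - pr h)) \<bullet> (c - z) \<le> 0"
        using N by (auto simp: normal_cone_def)
      moreover have "(v + (h - pr h)) \<bullet> pr h = 0"
        using pr(2)[OF span_base[OF N]] by (simp add: inner_commute)
      ultimately show "(v + (h - pr h)) \<bullet> (c - (z + pr h)) \<le> 0"
        by (simp add: inner_diff_right inner_add_right)
    qed
    then show "closest_point C y = z + pr (y - z)"
      unfolding eq by (intro closest_point_normal_cone[OF C mem]) (simp add: h_def algebra_simps)
  qed (use e r lin pr in auto)
qed

lemma regular_projection_flat:
  fixes C :: "(real^'n::finite) set"
  assumes C: "convex C" "closed C" and z: "z \<in> C"
    and v: "v \<in> rel_interior (normal_cone C z)"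
    and e: "0 < e"
    and flat: "\<And>w. (\<And>u. u \<in> normal_cone C z \<Longrightarrow> w \<bullet> u = 0) \<Longrightarrow> norm w < e \<Longrightarrow> z + w \<in> C"
  shows "regular_projection C z v"
proof -
  obtain V pr where V: "open V" "z + v \<in> V" and lin: "linear pr"
    and cp: "\<And>y. y \<in> V \<Longrightarrow> closest_point C y = z + pr (y - z)"
    and pr: "\<And>x. x - pr x \<in> span (normal_cone C z)"
    using projection_on_flat_face[OF assms] by metis
  have bl: "bounded_linear pr" using lin by (simp add: linear_conv_bounded_linear)
  have "ck_on k V (closest_point C)" for k
  proof (rule ck_on_cong[OF _ V(1)])
    show "ck_on k V (\<lambda>y. z + pr (y - z))"
      by (intro ck_on_add ck_on_const ck_on_bounded_linear[OF bl] ck_on_diff ck_on_ident V)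
  qed (simp add: cp)
  then have "smooth_on V (closest_point C)"
    by (simp add: smooth_on_def)
  moreover have "((\<lambda>y. z + pr (y - z)) has_derivative pr) (at (z + v))"
    by (rule derivative_eq_intros bounded_linear.has_derivative[OF bl] refl)+ simp
  then have "(closest_point C has_derivative pr) (at (z + v))"
    by (rule has_derivative_transform_within_open) (use V cp in auto)
  then have "frechet_derivative (closest_point C) (at (z + v)) = pr"
    by (metis frechet_derivative_at)
  then have "d \<in> span (normal_cone C z)"
    if "frechet_derivative (closest_point C) (at (z + v)) d = 0" for d
    using pr[of d] that by simp
  ultimately show ?thesis
    unfolding regular_projection_def using V by blast
qed

text \<open>The component of a displacement orthogonal to the direction space is itself a normal, so
  a displacement orthogonal to all normals has no such component. This holds at any size; the radius
  1 is arbitrary.\<close>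

lemma regular_projection_affine:
  fixes C :: "(real^'n::finite) set"
  assumes "affine C" and z: "z \<in> C" and v: "v \<in> rel_interior (normal_cone C z)"
  shows "regular_projection C z v"
proof (rule regular_projection_flat[OF affine_imp_convex[OF assms(1)] affine_closed[OF assms(1)] z v,
    of 1])
  fix w assume w: "\<And>u. u \<in> normal_cone C z \<Longrightarrow> w \<bullet> u = 0"
  let ?L = "(\<lambda>x. x - z) ` C"
  have L: "subspace ?L"
    using affine_diffs_subspace_subtract[OF assms(1) z] .
  obtain a b where ab: "a \<in> span ?L" "\<And>x. x \<in> span ?L \<Longrightarrow> orthogonal b x" "w = a + b"
    using orthogonal_subspace_decomp_exists[of ?L w] by metis
  then have "b \<in> normal_cone C z"
    by (auto simp: normal_cone_def orthogonal_def span_base)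
  then have "b \<bullet> w = 0" using w by (metis inner_commute)
  moreover have "b \<bullet> a = 0" using ab by (auto simp: orthogonal_def)
  ultimately have "b = 0" using ab(3) by (simp add: inner_add_right)
  then have "w \<in> ?L" using ab L by (simp add: span_eq_iff[THEN iffD2])
  then show "z + w \<in> C" by auto
qed simp

section \<open>Vectors indexed by a disjoint sum\<close>

text \<open>A sum as index type keeps pairs such as (point, multipliers) inside a space of the form
  \<open>real^'k\<close>, where Jacobians and determinants are available;
  \<open>block_matrix\<close> uses the same indexing.\<close>

definition upper :: "'c^('a::finite + 'b::finite) \<Rightarrow> 'c^'a" where
  "upper x = (\<chi> i. x $ Inl i)"

definition lower :: "'c^('a::finite + 'b::finite) \<Rightarrow> 'c^'b" where
  "lower x = (\<chi> i. x $ Inr i)"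

definition stack :: "'c^'a::finite \<Rightarrow> 'c^'b::finite \<Rightarrow> 'c^('a + 'b)" where
  "stack a b = (\<chi> k. case k of Inl i \<Rightarrow> a $ i | Inr i \<Rightarrow> b $ i)"

lemma upper_stack [simp]: "upper (stack a b) = a"
  by (simp add: upper_def stack_def)

lemma lower_stack [simp]: "lower (stack a b) = b"
  by (simp add: lower_def stack_def)

lemma stack_upper_lower [simp]: "stack (upper x) (lower x) = x"
  by (auto simp: upper_def lower_def stack_def vec_eq_iff split: sum.split)

lemma stack_eq_iff: "stack a b = stack c d \<longleftrightarrow> a = c \<and> b = d"
  by (metis upper_stack lower_stack)

lemma stack_zero: "stack 0 0 = 0"
  by (auto simp: stack_def vec_eq_iff split: sum.split)

lemma stack_eq_0_iff: "stack a b = 0 \<longleftrightarrow> a = 0 \<and> b = 0"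
  by (metis stack_eq_iff stack_zero)

lemma bounded_linear_upper: "bounded_linear (upper :: real^('a::finite + 'b::finite) \<Rightarrow> real^'a)"
  unfolding linear_conv_bounded_linear[symmetric]
  by (rule linearI) (auto simp: upper_def vec_eq_iff)

lemma bounded_linear_lower: "bounded_linear (lower :: real^('a::finite + 'b::finite) \<Rightarrow> real^'b)"
  unfolding linear_conv_bounded_linear[symmetric]
  by (rule linearI) (auto simp: lower_def vec_eq_iff)

lemma bounded_linear_stack:
  "bounded_linear (\<lambda>p. stack (fst p) (snd p) :: real^('a::finite + 'b::finite))"
  unfolding linear_conv_bounded_linear[symmetric]
  by (rule linearI) (auto simp: stack_def vec_eq_iff split: sum.split)

lemma bounded_linear_stack_left: "bounded_linear (\<lambda>a. stack a 0 :: real^('a::finite + 'b::finite))"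
  unfolding linear_conv_bounded_linear[symmetric]
  by (rule linearI) (auto simp: stack_def vec_eq_iff split: sum.split)

lemma bounded_linear_axis: "bounded_linear (axis i :: real \<Rightarrow> real^'i::finite)"
  unfolding linear_conv_bounded_linear[symmetric]
  by (rule linearI) (auto simp: axis_def vec_eq_iff)

lemma ck_on_stack:
  fixes f :: "'c::real_normed_vector \<Rightarrow> real^'a::finite" and g :: "'c \<Rightarrow> real^'b::finite"
  assumes "open S" "ck_on k S f" "ck_on k S g"
  shows "ck_on k S (\<lambda>x. stack (f x) (g x))"
  unfolding stack_def
proof (rule ck_on_vec[OF assms(1)])
  show "ck_on k S (\<lambda>x. case i of Inl i \<Rightarrow> f x $ i | Inr i \<Rightarrow> g x $ i)" for i
    using assms by (cases i) (auto intro!: ck_on_nth)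
qed

lemma has_derivative_vec:
  fixes f :: "'i::finite \<Rightarrow> 'a::real_normed_vector \<Rightarrow> real"
  assumes "\<And>i. (f i has_derivative f' i) F"
  shows "((\<lambda>x. \<chi> i. f i x) has_derivative (\<lambda>h. \<chi> i. f' i h)) F"
proof -
  have "((\<lambda>x. \<Sum>i\<in>UNIV. axis i (f i x)) has_derivative (\<lambda>h. \<Sum>i\<in>UNIV. axis i (f' i h))) F"
    by (intro has_derivative_sum bounded_linear.has_derivative[OF bounded_linear_axis] assms)
  moreover have "(\<Sum>i\<in>UNIV. axis i (c i)) = (\<chi> i. c i)" for c :: "'i \<Rightarrow> real"
    by (simp add: vec_eq_iff axis_def)
  ultimately show ?thesis by simp
qed


section \<open>Convex functions along smooth arguments\<close>

lemma gradient_has_derivative: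
  fixes f :: "real^'n::finite \<Rightarrow> real"
  assumes "f differentiable (at x)"
  shows "(f has_derivative (\<lambda>h. gradient f x \<bullet> h)) (at x)"
proof -
  let ?D = "frechet_derivative f (at x)"
  have D: "(f has_derivative ?D) (at x)"
    using assms by (simp add: frechet_derivative_works)
  then have lin: "linear ?D" by (rule has_derivative_linear)
  have "?D h = gradient f x \<bullet> h" for h
  proof -
    have "?D h = ?D (\<Sum>i\<in>UNIV. h $ i *\<^sub>R axis i 1)"
      using basis_expansion[of h] by (simp add: scalar_mult_eq_scaleR)
    also have "\<dots> = (\<Sum>i\<in>UNIV. h $ i * ?D (axis i 1))"
      by (simp add: linear_sum[OF lin] linear_cmul[OF lin])
    finally show ?thesis by (simp add: gradient_def inner_vec_def mult.commute)
  qed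
  then show ?thesis using D by presburger
qed

lemma smooth_on_gradient:
  assumes "open S" "smooth_on S f"
  shows "smooth_on S (gradient f)"
  unfolding smooth_on_def
proof
  fix k
  show "ck_on k S (gradient f)"
    using ck_on_vec[OF assms(1), of k "\<lambda>i x. frechet_derivative f (at x) (axis i 1)"]
      smooth_on_ck[OF smooth_on_derivative[OF assms(2)]]
    by (simp add: gradient_def[abs_def])
qed

lemma has_real_derivative_along_line:
  fixes f :: "real^'n::finite \<Rightarrow> real"
  assumes "f differentiable (at x)"
  shows "((\<lambda>t. f (x + t *\<^sub>R h)) has_real_derivative gradient f x \<bullet> h) (at 0)"
proof -
  have "((\<lambda>t. x + t *\<^sub>R h) has_derivative (\<lambda>t. t *\<^sub>R h)) (at 0)"
    by (rule derivative_eq_intros refl)+ simp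
  moreover have "(f has_derivative (\<lambda>h. gradient f x \<bullet> h)) (at (x + 0 *\<^sub>R h))"
    using gradient_has_derivative[OF assms] by simp
  ultimately have "((\<lambda>t. f (x + t *\<^sub>R h)) has_derivative (\<lambda>t. gradient f x \<bullet> (t *\<^sub>R h))) (at 0)"
    using diff_chain_at[of "\<lambda>t. x + t *\<^sub>R h" _ 0] by (force simp: o_def)
  then show ?thesis
    by (simp add: has_field_derivative_def mult.commute[of _ "gradient f x \<bullet> h"])
qed

lemma convex_on_above_tangent:
  fixes f :: "real^'n::finite \<Rightarrow> real"
  assumes "convex_on UNIV f" "f differentiable (at x)"
  shows "f x + gradient f x \<bullet> (y - x) \<le> f y"
proof -
  let ?f = "\<lambda>t. f (x + t *\<^sub>R (y - x))"
  have "convex_on UNIV ?f"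
  proof (rule convex_onI)
    fix t a b :: real assume "0 < t" "t < 1"
    have "x + ((1 - t) *\<^sub>R a + t *\<^sub>R b) *\<^sub>R (y - x)
        = (1 - t) *\<^sub>R (x + a *\<^sub>R (y - x)) + t *\<^sub>R (x + b *\<^sub>R (y - x))"
      by (simp add: algebra_simps)
    then show "?f ((1 - t) *\<^sub>R a + t *\<^sub>R b) \<le> (1 - t) * ?f a + t * ?f b"
      using convex_onD[OF assms(1), of t "x + a *\<^sub>R (y - x)" "x + b *\<^sub>R (y - x)"]
        \<open>0 < t\<close> \<open>t < 1\<close> by simp
  qed simp
  from convex_on_imp_above_tangent[OF this, of 0 1 "gradient f x \<bullet> (y - x)"]
  show ?thesis
    using has_real_derivative_along_line[OF assms(2)] by simp
qed

lemma eventually_along_line: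
  fixes x :: "'a::real_normed_vector"
  assumes "open S" "x \<in> S"
  shows "\<forall>\<^sub>F t in at_right (0::real). x + t *\<^sub>R h \<in> S"
proof -
  have "((\<lambda>t. x + t *\<^sub>R h) \<longlongrightarrow> x + 0 *\<^sub>R h) (at_right 0)"
    by (intro tendsto_intros)
  from topological_tendstoD[OF this assms(1)] show ?thesis
    using assms(2) by simp
qed

text \<open>A negative value would make the slope along \<open>h\<close> decrease strictly just
  after \<open>x\<close>. Adding the tangent inequalities at \<open>x\<close> and at
  \<open>x + t *\<^sub>R h\<close> shows that this slope cannot decrease.\<close>

lemma convex_on_hessian_nonneg:
  fixes f :: "real^'n::finite \<Rightarrow> real"
  assumes S: "open S" "x \<in> S" and f: "convex_on UNIV f" "smooth_on S f"
  shows "0 \<le> frechet_derivative (gradient f) (at x) h \<bullet> h"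
proof (rule ccontr)
  assume neg: "\<not> ?thesis"
  let ?D = "frechet_derivative (gradient f) (at x)"
  have der: "(gradient f has_derivative ?D) (at x)"
    using smooth_on_differentiable[OF smooth_on_gradient[OF S(1) f(2)] S(2)]
    by (simp add: frechet_derivative_works)
  have "((\<lambda>t. x + t *\<^sub>R h) has_derivative (\<lambda>t. t *\<^sub>R h)) (at 0)"
    by (rule derivative_eq_intros refl)+ simp
  moreover have "(gradient f has_derivative ?D) (at (x + 0 *\<^sub>R h))"
    using der by simp
  ultimately have "((\<lambda>t. gradient f (x + t *\<^sub>R h)) has_derivative (\<lambda>t. ?D (t *\<^sub>R h))) (at 0)"
    using diff_chain_at[of "\<lambda>t. x + t *\<^sub>R h" _ 0] by (force simp: o_def)
  then have "((\<lambda>t. gradient f (x + t *\<^sub>R h) \<bullet> h) has_derivative (\<lambda>t. ?D (t *\<^sub>R h) \<bullet> h)) (at 0)"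
    by (rule has_derivative_inner_left)
  then have "((\<lambda>t. gradient f (x + t *\<^sub>R h) \<bullet> h) has_real_derivative ?D h \<bullet> h) (at 0)"
    by (simp add: has_field_derivative_def linear_cmul[OF has_derivative_linear[OF der]]
        mult.commute[of _ "?D h \<bullet> h"])
  from DERIV_neg_dec_right[OF this] neg obtain d where d: "d > 0"
    "\<And>t. 0 < t \<Longrightarrow> t < d \<Longrightarrow> gradient f (x + t *\<^sub>R h) \<bullet> h < gradient f x \<bullet> h"
    by auto
  have "\<forall>\<^sub>F t in at_right (0::real). x + t *\<^sub>R h \<in> S"
    using eventually_along_line[OF S] .
  moreover have "\<forall>\<^sub>F t in at_right (0::real). t < d" "\<forall>\<^sub>F t in at_right (0::real). 0 < t"
    using d(1) by (auto intro: eventually_at_right_less order_tendstoD)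
  ultimately have "\<forall>\<^sub>F t in at_right (0::real). x + t *\<^sub>R h \<in> S \<and> t < d \<and> 0 < t"
    by eventually_elim auto
  then obtain t where t: "x + t *\<^sub>R h \<in> S" "t < d" "0 < t"
    using eventually_happens'[OF trivial_limit_at_right_real] by blast
  have "f x + gradient f x \<bullet> (t *\<^sub>R h) \<le> f (x + t *\<^sub>R h)"
    using convex_on_above_tangent[OF f(1) smooth_on_differentiable[OF f(2) S(2)], of "x + t *\<^sub>R h"]
    by simp
  moreover have "f (x + t *\<^sub>R h) - gradient f (x + t *\<^sub>R h) \<bullet> (t *\<^sub>R h) \<le> f x"
    using convex_on_above_tangent[OF f(1) smooth_on_differentiable[OF f(2) t(1)], of x] by simp
  ultimately have "t * (gradient f x \<bullet> h) \<le> t * (gradient f (x + t *\<^sub>R h) \<bullet> h)"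
    by simp
  then show False using d(2)[OF t(3,2)] t(3) by simp
qed

section \<open>Projection onto a set with independent smooth convex constraints\<close>

text \<open>Prescribe the values 0 and 1 of a linear functional on the independent family;
  \<open>adjoint f 1\<close> is the vector representing that functional.\<close>

lemma dual_vectors_exist:
  fixes G :: "'i \<Rightarrow> 'a::euclidean_space"
  assumes "inj_on G A" "independent (G ` A)"
  obtains e where "\<And>l m. l \<in> A \<Longrightarrow> m \<in> A \<Longrightarrow> G m \<bullet> e l = (if m = l then 1 else 0)"
proof -
  have "\<exists>a. \<forall>m\<in>A. G m \<bullet> a = (if m = l then 1 else 0)" for l
  proof -
    obtain f :: "'a \<Rightarrow> real" where f: "linear f" "\<forall>x\<in>G ` A. f x = (if inv_into A G x = l then 1 else 0)"
      using linear_independent_extend[OF assms(2), of "\<lambda>x. if inv_into A G x = l then 1 else 0"] by blast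
    have "x \<bullet> adjoint f 1 = f x" for x
      using adjoint_works[OF f(1), of x 1] by simp
    then show ?thesis
      using f(2) assms(1) by (intro exI[of _ "adjoint f 1"]) auto
  qed
  then show ?thesis using that by metis
qed

text \<open>\<open>A\<close> collects the constraints active at \<open>z\<close>; by
  \<open>C_local\<close> the others are absorbed into the choice of \<open>S\<close>. Smoothness is
  demanded on \<open>S\<close> only, so that functions such as a norm, smooth away from a singular
  set, are covered. The finite index type makes the multipliers a vector.\<close>

locale smooth_convex_constraints =
  fixes C :: "(real^'n::finite) set" and z :: "real^'n" and S :: "(real^'n) set"
    and A :: "'i::finite set" and \<phi> :: "'i \<Rightarrow> real^'n \<Rightarrow> real"
  assumes C: "convex C" "closed C" and z: "z \<in> C" and S: "open S" "z \<in> S"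
    and smooth: "\<And>l. l \<in> A \<Longrightarrow> smooth_on S (\<phi> l)"
    and conv: "\<And>l. l \<in> A \<Longrightarrow> convex_on UNIV (\<phi> l)"
    and C_le: "\<And>x l. x \<in> C \<Longrightarrow> l \<in> A \<Longrightarrow> \<phi> l x \<le> 0"
    and C_local: "\<And>x. x \<in> S \<Longrightarrow> (\<And>l. l \<in> A \<Longrightarrow> \<phi> l x \<le> 0) \<Longrightarrow> x \<in> C"
    and active: "\<And>l. l \<in> A \<Longrightarrow> \<phi> l z = 0"
    and inj: "inj_on (\<lambda>l. gradient (\<phi> l) z) A"
    and indep: "independent ((\<lambda>l. gradient (\<phi> l) z) ` A)"
begin

abbreviation "G \<equiv> \<lambda>l. gradient (\<phi> l)"

lemma gradient_normal:
  assumes "l \<in> A" "x \<in> S" "\<phi> l x = 0"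
  shows "G l x \<in> normal_cone C x"
  unfolding normal_cone_def
proof safe
  fix y assume "y \<in> C"
  then show "G l x \<bullet> (y - x) \<le> 0"
    using convex_on_above_tangent[OF conv smooth_on_differentiable[OF smooth]] assms C_le
    by (smt (verit, best))
qed

text \<open>A Farkas argument made explicit by the dual vectors: they read off the multipliers.
  Directions that strictly decrease all active constraints are feasible, which bounds
  \<open>v\<close> on them; a perturbation extends the bound to weakly decreasing directions, and
  testing suitable ones determines \<open>v\<close>.\<close>

lemma normal_multipliers:
  assumes "v \<in> normal_cone C z"
    and e: "\<And>l m. l \<in> A \<Longrightarrow> m \<in> A \<Longrightarrow> G m z \<bullet> e l = (if m = l then 1 else 0)"
  shows "v = (\<Sum>l\<in>A. (v \<bullet> e l) *\<^sub>R G l z)" and "\<And>l. l \<in> A \<Longrightarrow> 0 \<le> v \<bullet> e l"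
proof -
  have strict: "v \<bullet> h \<le> 0" if h: "\<And>l. l \<in> A \<Longrightarrow> G l z \<bullet> h < 0" for h
  proof -
    have "\<forall>\<^sub>F t in at_right (0::real). \<phi> l (z + t *\<^sub>R h) < 0" if l: "l \<in> A" for l
    proof -
      have "\<phi> l differentiable (at z)"
        using smooth_on_differentiable[OF smooth[OF l] S(2)] .
      from DERIV_neg_dec_right[OF has_real_derivative_along_line[OF this] h[OF l]]
      obtain d where "d > 0" "\<forall>t>0. t < d \<longrightarrow> \<phi> l (z + t *\<^sub>R h) < 0"
        using active[OF l] by auto
      then show ?thesis
        unfolding eventually_at_right_field by auto
    qed
    then have "\<forall>\<^sub>F t in at_right (0::real). \<forall>l\<in>A. \<phi> l (z + t *\<^sub>R h) < 0"
      by (simp add: eventually_ball_finite)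
    moreover have "\<forall>\<^sub>F t in at_right (0::real). 0 < t"
      by (rule eventually_at_right_less)
    ultimately have "\<forall>\<^sub>F t in at_right (0::real). 0 < t \<and> z + t *\<^sub>R h \<in> C"
      using eventually_along_line[OF S, of h]
      by eventually_elim (auto intro!: C_local less_imp_le)
    then obtain t :: real where t: "0 < t" "z + t *\<^sub>R h \<in> C"
      using eventually_happens'[OF trivial_limit_at_right_real] by blast
    then have "v \<bullet> (t *\<^sub>R h) \<le> 0"
      using assms(1) by (force simp: normal_cone_def)
    then show ?thesis using t(1) by (simp add: mult_le_0_iff)
  qed
  \<comment> \<open>A common strict descent direction, with slope -1 for every active
    constraint.\<close>
  define h0 where "h0 = - (\<Sum>l\<in>A. e l)"
  have h0: "G l z \<bullet> h0 = -1" if "l \<in> A" for l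
    using that by (simp add: h0_def inner_sum_right e)
  have weak: "v \<bullet> h \<le> 0" if h: "\<And>l. l \<in> A \<Longrightarrow> G l z \<bullet> h \<le> 0" for h
  proof (rule ccontr)
    assume "\<not> ?thesis"
    then have pos: "v \<bullet> h > 0" by simp
    \<comment> \<open>Small enough that the perturbation by \<open>d *\<^sub>R h0\<close> cannot
      cancel \<open>v \<bullet> h\<close>; the summand 1 keeps the denominator positive.\<close>
    define d where "d = (v \<bullet> h) / (\<bar>v \<bullet> h0\<bar> + 1)"
    have "d > 0" using pos by (simp add: d_def)
    have "v \<bullet> (h + d *\<^sub>R h0) \<le> 0"
    proof (rule strict)
      fix l assume "l \<in> A"
      then have "G l z \<bullet> (d *\<^sub>R h0) < 0" "G l z \<bullet> h \<le> 0"
        using h0 h \<open>d > 0\<close> by auto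
      then show "G l z \<bullet> (h + d *\<^sub>R h0) < 0"
        unfolding inner_add_right by linarith
    qed
    then have "v \<bullet> h \<le> d * \<bar>v \<bullet> h0\<bar>"
      using \<open>d > 0\<close> abs_le_D2[of "v \<bullet> h0" "\<bar>v \<bullet> h0\<bar>"] mult_left_mono[of "- (v \<bullet> h0)" "\<bar>v \<bullet> h0\<bar>" d]
      by (simp add: inner_add_right)
    also have "\<dots> < v \<bullet> h"
      using pos by (simp add: d_def field_simps)
    finally show False by simp
  qed
  show "0 \<le> v \<bullet> e l" if "l \<in> A" for l
    using weak[of "- e l"] e[OF that] by fastforce
  have "v \<bullet> h = (\<Sum>l\<in>A. (v \<bullet> e l) *\<^sub>R G l z) \<bullet> h" for h
  proof -
    \<comment> \<open>Removing the gradient components makes both \<open>k\<close> and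
      \<open>- k\<close> weakly decreasing, so \<open>v\<close> vanishes on
      \<open>k\<close>.\<close>
    define k where "k = h - (\<Sum>l\<in>A. (G l z \<bullet> h) *\<^sub>R e l)"
    have "G l z \<bullet> k = 0" if "l \<in> A" for l
    proof -
      have "G l z \<bullet> k = G l z \<bullet> h - (\<Sum>m\<in>A. (G m z \<bullet> h) * (if l = m then 1 else 0))"
        by (simp add: k_def inner_diff_right inner_sum_right e that)
      then show ?thesis using that by (simp add: if_distrib cong: if_cong)
    qed
    then have "v \<bullet> k = 0"
      using weak[of k] weak[of "- k"] by simp
    then show ?thesis
      by (simp add: k_def inner_diff_right inner_sum_right inner_sum_left mult.commute)
  qed
  then show "v = (\<Sum>l\<in>A. (v \<bullet> e l) *\<^sub>R G l z)"
    using vector_eq_rdot by blast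
qed

text \<open>A relatively interior \<open>v\<close> can be prolonged beyond itself, away from the sum
  \<open>u\<close> of all gradients, inside the cone. The multipliers of \<open>u\<close> are all 1,
  so nonnegativity at the prolonged point, \<open>(1 - s) + s * (v \<bullet> e l) \<ge> 0\<close>
  with \<open>s > 1\<close>, makes those of \<open>v\<close> positive.\<close>

lemma positive_multipliers:
  assumes v: "v \<in> rel_interior (normal_cone C z)"
  obtains c where "v = (\<Sum>l\<in>A. c l *\<^sub>R G l z)" "\<And>l. l \<in> A \<Longrightarrow> 0 < c l"
proof -
  obtain e where e: "\<And>l m. l \<in> A \<Longrightarrow> m \<in> A \<Longrightarrow> G m z \<bullet> e l = (if m = l then 1 else 0)"
    using dual_vectors_exist[OF inj indep] by metis
  define u where "u = (\<Sum>l\<in>A. G l z)"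
  have "u \<in> normal_cone C z"
    unfolding u_def by (intro normal_cone_sum gradient_normal S active)
  then obtain s where s: "s > 1" "(1 - s) *\<^sub>R u + s *\<^sub>R v \<in> normal_cone C z"
    using convex_rel_interior_iff[OF convex_normal_cone] v normal_cone_zero by blast
  have vN: "v \<in> normal_cone C z" using v rel_interior_subset by blast
  have "0 < v \<bullet> e l" if l: "l \<in> A" for l
  proof -
    have "u \<bullet> e l = 1"
      using l by (simp add: u_def inner_sum_left e)
    moreover have "0 \<le> ((1 - s) *\<^sub>R u + s *\<^sub>R v) \<bullet> e l"
      using normal_multipliers(2)[OF s(2) e] l by blast
    ultimately have "s - 1 \<le> s * (v \<bullet> e l)" by (simp add: inner_add_left)
    then have "0 < s * (v \<bullet> e l)" using s(1) by linarith
    then show ?thesis using s(1) by (simp add: zero_less_mult_iff)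
  qed
  then show ?thesis
    using that[of "\<lambda>l. v \<bullet> e l"] normal_multipliers(1)[OF vN e] by blast
qed

text \<open>The optimality system of the projection of \<open>y\<close>, with the multipliers of the constraints
  outside \<open>A\<close> set to zero, reads \<open>kkt x = stack y 0\<close> for \<open>x = stack (projection) (multipliers)\<close>.\<close>

definition kkt :: "real^('n + 'i) \<Rightarrow> real^('n + 'i)" where
  "kkt x = stack (upper x + (\<Sum>l\<in>A. lower x $ l *\<^sub>R G l (upper x)))
     (\<chi> l. if l \<in> A then \<phi> l (upper x) else lower x $ l)"

lemma open_upper_vimage: "open {x :: real^('n + 'i). upper x \<in> S}"
proof -
  have "continuous_on UNIV (upper :: real^('n + 'i) \<Rightarrow> real^'n)"
    using bounded_linear_upper by (rule linear_continuous_on)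
  from open_vimage[OF S(1) this] show ?thesis by (simp add: vimage_def)
qed

lemma smooth_on_kkt: "smooth_on {x. upper x \<in> S} kkt"
  unfolding smooth_on_def
proof
  fix k
  let ?T = "{x :: real^('n + 'i). upper x \<in> S}"
  note T = open_upper_vimage
  have up: "ck_on k ?T upper" and lo: "ck_on k ?T lower"
    by (intro ck_on_linear bounded_linear_upper bounded_linear_lower T)+
  have \<phi>: "ck_on k ?T (\<lambda>x. \<phi> l (upper x))" if "l \<in> A" for l
    using ck_on_compose[OF T _ up smooth_on_ck[OF smooth[OF that]]] by blast
  have G: "ck_on k ?T (\<lambda>x. G l (upper x))" if "l \<in> A" for l
    using ck_on_compose[OF T _ up smooth_on_ck[OF smooth_on_gradient[OF S(1) smooth[OF that]]]]
    by blast
  have "ck_on k ?T (\<lambda>x. upper x + (\<Sum>l\<in>A. lower x $ l *\<^sub>R G l (upper x)))"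
    by (intro ck_on_add T up ck_on_sum ck_on_scaleR ck_on_nth lo G)
  moreover have "ck_on k ?T (\<lambda>x. \<chi> l. if l \<in> A then \<phi> l (upper x) else lower x $ l)"
  proof (rule ck_on_vec[OF T])
    show "ck_on k ?T (\<lambda>x. if l \<in> A then \<phi> l (upper x) else lower x $ l)" for l
      using \<phi>[of l] ck_on_nth[OF T lo] by (cases "l \<in> A") auto
  qed
  ultimately show "ck_on k ?T kkt"
    unfolding kkt_def[abs_def] by (rule ck_on_stack[OF T])
qed

lemma kkt_has_derivative:
  assumes "upper x \<in> S"
  shows "(kkt has_derivative (\<lambda>h. stack
      (upper h + (\<Sum>l\<in>A. lower x $ l *\<^sub>R frechet_derivative (G l) (at (upper x)) (upper h)
        + lower h $ l *\<^sub>R G l (upper x)))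
      (\<chi> l. if l \<in> A then G l (upper x) \<bullet> upper h else lower h $ l))) (at x)"
proof -
  note up = bounded_linear.has_derivative[OF bounded_linear_upper has_derivative_ident]
  note lo = bounded_linear.has_derivative[OF bounded_linear_vec_nth
      bounded_linear.has_derivative[OF bounded_linear_lower has_derivative_ident]]
  have \<phi>: "((\<lambda>x. \<phi> l (upper x)) has_derivative (\<lambda>h. G l (upper x) \<bullet> upper h)) (at x)"
    if "l \<in> A" for l
    using diff_chain_at[OF up gradient_has_derivative[OF
          smooth_on_differentiable[OF smooth[OF that] assms]]] by (simp add: o_def)
  have "(G l has_derivative frechet_derivative (G l) (at (upper x))) (at (upper x))"
    if "l \<in> A" for l
    using smooth_on_differentiable[OF smooth_on_gradient[OF S(1) smooth[OF that]] assms]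
    by (simp add: frechet_derivative_works)
  from diff_chain_at[OF up this]
  have G: "((\<lambda>x. G l (upper x)) has_derivative
      (\<lambda>h. frechet_derivative (G l) (at (upper x)) (upper h))) (at x)" if "l \<in> A" for l
    using that by (simp add: o_def)
  have "((\<lambda>x. upper x + (\<Sum>l\<in>A. lower x $ l *\<^sub>R G l (upper x))) has_derivative
      (\<lambda>h. upper h + (\<Sum>l\<in>A. lower x $ l *\<^sub>R frechet_derivative (G l) (at (upper x)) (upper h)
        + lower h $ l *\<^sub>R G l (upper x)))) (at x)"
    by (intro has_derivative_add up has_derivative_sum has_derivative_scaleR lo G)
  note 1 = this
  have "((\<lambda>x. if l \<in> A then \<phi> l (upper x) else lower x $ l) has_derivative
      (\<lambda>h. if l \<in> A then G l (upper x) \<bullet> upper h else lower h $ l)) (at x)" for l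
    using \<phi>[of l] lo by (cases "l \<in> A") auto
  from bounded_linear.has_derivative[OF bounded_linear_stack
      has_derivative_Pair[OF 1 has_derivative_vec[OF this]]]
  show ?thesis unfolding kkt_def[abs_def] by simp
qed

lemma kkt_derivative:
  assumes "upper x \<in> S"
  shows "frechet_derivative kkt (at x) h = stack
      (upper h + (\<Sum>l\<in>A. lower x $ l *\<^sub>R frechet_derivative (G l) (at (upper x)) (upper h)
        + lower h $ l *\<^sub>R G l (upper x)))
      (\<chi> l. if l \<in> A then G l (upper x) \<bullet> upper h else lower h $ l)"
  by (simp add: frechet_derivative_at[OF kkt_has_derivative[OF assms], symmetric])

text \<open>An energy argument: pair the linearized stationarity equation with
  \<open>upper h\<close>. The gradient terms vanish by the linearized constraints and the Hessian
  terms are nonnegative, so \<open>upper h\<close> is zero. Independence of the gradients then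
  removes the multiplier part.\<close>

lemma kkt_derivative_injective:
  assumes c: "\<And>l. l \<in> A \<Longrightarrow> 0 < c l"
    and h: "frechet_derivative kkt (at (stack z (\<chi> l. if l \<in> A then c l else 0))) h = 0"
  shows "h = 0"
proof -
  let ?x = "stack z (\<chi> l. if l \<in> A then c l else 0)"
  let ?D = "\<lambda>l. frechet_derivative (G l) (at z) (upper h)"
  have D: "stack
      (upper h + (\<Sum>l\<in>A. c l *\<^sub>R ?D l + lower h $ l *\<^sub>R G l z))
      (\<chi> l. if l \<in> A then G l z \<bullet> upper h else lower h $ l) = 0"
    using h kkt_derivative[of ?x h] S(2) by (simp cong: if_cong)
  then have 1: "upper h + (\<Sum>l\<in>A. c l *\<^sub>R ?D l + lower h $ l *\<^sub>R G l z) = 0"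
    and "(\<chi> l. if l \<in> A then G l z \<bullet> upper h else lower h $ l) = 0"
    unfolding stack_eq_0_iff by blast+
  then have 2: "(if l \<in> A then G l z \<bullet> upper h else lower h $ l) = 0" for l
    by (simp add: vec_eq_iff)
  have orth: "G l z \<bullet> upper h = 0" if "l \<in> A" for l using 2[of l] that by simp
  have "(upper h + (\<Sum>l\<in>A. c l *\<^sub>R ?D l + lower h $ l *\<^sub>R G l z)) \<bullet> upper h
      = upper h \<bullet> upper h + (\<Sum>l\<in>A. c l * (?D l \<bullet> upper h))"
    using orth by (simp add: inner_add_left inner_sum_left)
  moreover have "0 \<le> (\<Sum>l\<in>A. c l * (?D l \<bullet> upper h))"
    using c convex_on_hessian_nonneg[OF S conv smooth]
    by (intro sum_nonneg mult_nonneg_nonneg) (auto intro: less_imp_le)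
  moreover have "0 \<le> upper h \<bullet> upper h" by simp
  ultimately have "upper h \<bullet> upper h = 0"
    unfolding 1 inner_zero_left by linarith
  then have up: "upper h = 0" by simp
  have "linear (frechet_derivative (G l) (at z))" if "l \<in> A" for l
    using smooth_on_differentiable[OF smooth_on_gradient[OF S(1) smooth[OF that]] S(2)]
    by (rule linear_frechet_derivative)
  then have "?D l = 0" if "l \<in> A" for l using that up by (simp add: linear_0)
  then have sum0: "(\<Sum>l\<in>A. lower h $ l *\<^sub>R G l z) = 0" using 1 up by simp
  obtain e where e: "\<And>l m. l \<in> A \<Longrightarrow> m \<in> A \<Longrightarrow> G m z \<bullet> e l = (if m = l then 1 else 0)"
    using dual_vectors_exist[OF inj indep] by metis
  have "lower h $ l = 0" for l
  proof (cases "l \<in> A")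
    case True
    have "(\<Sum>m\<in>A. lower h $ m *\<^sub>R G m z) \<bullet> e l = (\<Sum>m\<in>A. lower h $ m * (if m = l then 1 else 0))"
      unfolding inner_sum_left using True e by (intro sum.cong) auto
    then show ?thesis using sum0 True by (simp add: if_distrib cong: if_cong)
  qed (use 2[of l] in simp)
  then have "lower h = 0" by (simp add: vec_eq_iff)
  with up show ?thesis by (metis stack_upper_lower stack_zero)
qed

text \<open>Near \<open>z + v\<close> the projection is the upper part of the local inverse of
  \<open>kkt\<close> at \<open>stack y 0\<close>, which gives smoothness and, through the derivative
  of that inverse, the kernel.\<close>

lemma regular_projection:
  assumes v: "v \<in> rel_interior (normal_cone C z)"
  shows "regular_projection C z v"
proof -
  obtain c where vc: "v = (\<Sum>l\<in>A. c l *\<^sub>R G l z)" and c: "\<And>l. l \<in> A \<Longrightarrow> 0 < c l"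
    using positive_multipliers[OF v] by metis
  let ?T = "{x :: real^('n + 'i). upper x \<in> S}"
  define x0 :: "real^('n + 'i)" where "x0 = stack z (\<chi> l. if l \<in> A then c l else 0)"
  have kkt0: "kkt x0 = stack (z + v) 0"
    by (simp add: kkt_def x0_def vc active stack_eq_iff zero_vec_def cong: if_cong)
  have x0T: "x0 \<in> ?T" using S(2) by (simp add: x0_def)
  have inj_kkt: "h = 0" if "frechet_derivative kkt (at x0) h = 0" for h
    using kkt_derivative_injective[of c h] c that by (simp add: x0_def)
  obtain V g where V: "open V" "stack (z + v) 0 \<in> V" and g: "smooth_on V g"
    and g0: "g (stack (z + v) 0) = x0"
    and gV: "\<And>y. y \<in> V \<Longrightarrow> upper (g y) \<in> S \<and> kkt (g y) = y"
    and gD: "\<And>d. frechet_derivative kkt (at x0)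
        (frechet_derivative g (at (stack (z + v) 0)) d) = d"
    by (rule smooth_local_inverse[OF open_upper_vimage x0T smooth_on_kkt inj_kkt, unfolded kkt0])
      auto
  \<comment> \<open>On \<open>V1\<close> the multipliers stay positive, so a solution of the
    equations has its residual in the normal cone and is the projection.\<close>
  define V1 where "V1 = V \<inter> g -` {x. \<forall>l\<in>A. 0 < lower x $ l}"
  have "open {x :: real^('n + 'i). \<forall>l\<in>A. 0 < lower x $ l}"
  proof -
    have "continuous_on UNIV (\<lambda>x :: real^('n + 'i). lower x $ l)" for l
      using ck_on_nth[OF open_UNIV ck_on_linear[OF bounded_linear_lower open_UNIV], of 0 l] by simp
    then have "open {x :: real^('n + 'i). 0 < lower x $ l}" for l
      by (intro open_Collect_less continuous_on_const)
    then have "open (\<Inter>l\<in>A. {x :: real^('n + 'i). 0 < lower x $ l})"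
      by (intro open_INT) auto
    moreover have "{x :: real^('n + 'i). \<forall>l\<in>A. 0 < lower x $ l} = (\<Inter>l\<in>A. {x. 0 < lower x $ l})"
      by auto
    ultimately show ?thesis by simp
  qed
  then have V1: "open V1"
    unfolding V1_def by (rule continuous_open_preimage[OF smooth_on_continuous[OF g] V(1)])
  define W where "W = (\<lambda>y. stack y 0 :: real^('n + 'i)) -` V1"
  have W: "open W"
    unfolding W_def by (intro open_vimage[OF V1] linear_continuous_on bounded_linear_stack_left)
  have zW: "z + v \<in> W"
    using V(2) g0 c by (simp add: W_def V1_def x0_def)
  have cp: "closest_point C y = upper (g (stack y 0))" if "y \<in> W" for y
  proof -
    let ?x = "g (stack y 0)"
    have yV: "stack y 0 \<in> V" and pos: "\<And>l. l \<in> A \<Longrightarrow> 0 < lower ?x $ l"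
      using that by (auto simp: W_def V1_def)
    have S': "upper ?x \<in> S" and "kkt ?x = stack y 0" using gV[OF yV] by auto
    then have y: "y = upper ?x + (\<Sum>l\<in>A. lower ?x $ l *\<^sub>R G l (upper ?x))"
      and "(\<chi> l. if l \<in> A then \<phi> l (upper ?x) else lower ?x $ l) = 0"
      by (auto simp: kkt_def stack_eq_iff)
    then have \<phi>: "(if l \<in> A then \<phi> l (upper ?x) else lower ?x $ l) = 0" for l
      by (simp add: vec_eq_iff)
    have \<phi>0: "\<phi> l (upper ?x) = 0" if "l \<in> A" for l
      using \<phi>[of l] that by simp
    have "y - upper ?x = (\<Sum>l\<in>A. lower ?x $ l *\<^sub>R G l (upper ?x))"
      by (subst y) simp
    also have "\<dots> \<in> normal_cone C (upper ?x)"
      using \<phi>0 pos S' by (intro normal_cone_sum normal_cone_scale gradient_normal) (auto intro: less_imp_le)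
    finally show ?thesis
      using C_local[OF S'] \<phi>0 by (intro closest_point_normal_cone[OF C]) auto
  qed
  have ckW: "ck_on k W (\<lambda>y. upper (g (stack y 0)))" for k
  proof (rule ck_on_bounded_linear[OF bounded_linear_upper W])
    show "ck_on k W (\<lambda>y. g (stack y 0))"
      by (rule ck_on_compose[OF W _ ck_on_linear[OF bounded_linear_stack_left W] smooth_on_ck[OF g]])
        (auto simp: W_def V1_def)
  qed
  have "ck_on k W (closest_point C)" for k
    by (rule ck_on_cong[OF ckW W]) (simp add: cp)
  then have "smooth_on W (closest_point C)" by (simp add: smooth_on_def)
  \<comment> \<open>If the projection does not move to first order, the linearized stationarity
    equation leaves \<open>d\<close> as a combination of the gradients, which are normals.\<close>
  moreover have "d \<in> span (normal_cone C z)"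
    if d: "frechet_derivative (closest_point C) (at (z + v)) d = 0" for d
  proof -
    let ?k = "frechet_derivative g (at (stack (z + v) 0)) (stack d 0)"
    have "(g has_derivative frechet_derivative g (at (stack (z + v) 0))) (at (stack (z + v) 0))"
      using smooth_on_differentiable[OF g V(2)] by (simp add: frechet_derivative_works)
    from bounded_linear.has_derivative[OF bounded_linear_upper diff_chain_at[OF
          bounded_linear.has_derivative[OF bounded_linear_stack_left has_derivative_ident] this]]
    have "((\<lambda>y. upper (g (stack y 0))) has_derivative
        (\<lambda>d. upper (frechet_derivative g (at (stack (z + v) 0)) (stack d 0)))) (at (z + v))"
      by (simp add: o_def)
    then have "(closest_point C has_derivative
        (\<lambda>d. upper (frechet_derivative g (at (stack (z + v) 0)) (stack d 0)))) (at (z + v))"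
      by (rule has_derivative_transform_within_open[OF _ W zW]) (simp add: cp)
    then have up: "upper ?k = 0"
      using d by (metis frechet_derivative_at)
    have "upper x0 \<in> S" using x0T by simp
    from gD[of "stack d 0"] kkt_derivative[OF this]
    have "d = upper ?k + (\<Sum>l\<in>A. lower x0 $ l *\<^sub>R frechet_derivative (G l) (at z) (upper ?k)
        + lower ?k $ l *\<^sub>R G l z)"
      by (simp add: stack_eq_iff x0_def)
    moreover have "frechet_derivative (G l) (at z) (upper ?k) = 0" if "l \<in> A" for l
      using linear_0[OF linear_frechet_derivative[OF smooth_on_differentiable[OF
              smooth_on_gradient[OF S(1) smooth[OF that]] S(2)]]] up by simp
    ultimately have "d = (\<Sum>l\<in>A. lower ?k $ l *\<^sub>R G l z)" using up by simp
    moreover have "(\<Sum>l\<in>A. lower ?k $ l *\<^sub>R G l z) \<in> span (normal_cone C z)"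
      by (intro span_sum span_scale span_base gradient_normal S active)
    ultimately show ?thesis by simp
  qed
  ultimately show ?thesis
    unfolding regular_projection_def using W zW by blast
qed

end

text \<open>Independence bounds the number of active constraints by the dimension, so they can be
  reindexed by coordinates. This supplies the finite index type required by the locale.\<close>

lemma regular_projection_smooth_constraints:
  fixes C :: "(real^'n::finite) set" and A :: "'l set"
  assumes C: "convex C" "closed C" and z: "z \<in> C" and S: "open S" "z \<in> S" and A: "finite A"
    and smooth: "\<And>l. l \<in> A \<Longrightarrow> smooth_on S (\<phi> l)"
    and conv: "\<And>l. l \<in> A \<Longrightarrow> convex_on UNIV (\<phi> l)"
    and C_le: "\<And>x l. x \<in> C \<Longrightarrow> l \<in> A \<Longrightarrow> \<phi> l x \<le> 0"
    and C_local: "\<And>x. x \<in> S \<Longrightarrow> (\<And>l. l \<in> A \<Longrightarrow> \<phi> l x \<le> 0) \<Longrightarrow> x \<in> C"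
    and active: "\<And>l. l \<in> A \<Longrightarrow> \<phi> l z = 0"
    and inj: "inj_on (\<lambda>l. gradient (\<phi> l) z) A"
    and indep: "independent ((\<lambda>l. gradient (\<phi> l) z) ` A)"
    and v: "v \<in> rel_interior (normal_cone C z)"
  shows "regular_projection C z v"
proof -
  let ?G = "\<lambda>l. gradient (\<phi> l) z"
  have "card A \<le> CARD('n)"
    using independent_bound[OF indep] card_image[OF inj] by simp
  then obtain f :: "'l \<Rightarrow> 'n" where f: "inj_on f A"
    using card_le_inj[OF A, of "UNIV :: 'n set"] by auto
  let ?g = "inv_into A f"
  have g: "?g c \<in> A" if "c \<in> f ` A" for c using that by (rule inv_into_into)
  have g_inj: "inj_on ?g (f ` A)" and g_img: "?g ` f ` A = A"
    using f by (auto simp: inj_on_inv_into image_image)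
  interpret smooth_convex_constraints C z S "f ` A" "\<lambda>c. \<phi> (?g c)"
  proof
    show "x \<in> C" if "x \<in> S" "\<And>c. c \<in> f ` A \<Longrightarrow> \<phi> (?g c) x \<le> 0" for x
    proof (rule C_local[OF that(1)])
      show "\<phi> l x \<le> 0" if "l \<in> A" for l
        using \<open>\<And>c. c \<in> f ` A \<Longrightarrow> \<phi> (?g c) x \<le> 0\<close>[of "f l"] that f by simp
    qed
    have "inj_on (?G \<circ> ?g) (f ` A)"
      by (rule comp_inj_on[OF g_inj]) (simp add: g_img inj)
    then show "inj_on (\<lambda>c. gradient (\<phi> (?g c)) z) (f ` A)"
      by (simp add: o_def)
    have "(\<lambda>c. gradient (\<phi> (?g c)) z) ` f ` A = ?G ` (?g ` f ` A)"
      by (simp only: image_image)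
    from this[unfolded g_img] show "independent ((\<lambda>c. gradient (\<phi> (?g c)) z) ` f ` A)"
      by (rule ssubst) (rule indep)
  qed (use assms g in auto)
  show ?thesis using regular_projection[OF v] .
qed


section \<open>Second-order cones\<close>

text \<open>\<open>L\<close> is the orthogonal projection onto the vector part and \<open>e\<close> the scalar direction; the
  remaining directions of the space are unconstrained.\<close>

locale cone_cylinder =
  fixes L :: "real^'n::finite \<Rightarrow> real^'n" and e :: "real^'n" and t :: real and C :: "(real^'n) set"
  assumes linear_L: "linear L" and idem: "\<And>x. L (L x) = L x"
    and self_adjoint: "\<And>x y. L x \<bullet> y = x \<bullet> L y"
    and e: "norm e = 1" "L e = 0" and t: "0 \<le> t"
    and C_eq: "C = {x. norm (L x) \<le> t * (x \<bullet> e) \<and> 0 \<le> x \<bullet> e}"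
begin

lemma bounded_linear_L: "bounded_linear L"
  using linear_L by (simp add: linear_conv_bounded_linear)

lemma continuous_L: "continuous_on S L"
  by (rule linear_continuous_on[OF bounded_linear_L])

lemma L_orthogonal: "x \<bullet> L x = norm (L x) ^ 2"
  using self_adjoint[of x "L x"] by (simp add: idem power2_norm_eq_inner)

lemma convex_C: "convex C"
  unfolding C_eq
proof (rule convexI, safe)
  fix x y :: "real^'n" and a b :: real
  assume x: "norm (L x) \<le> t * (x \<bullet> e)" "0 \<le> x \<bullet> e" and y: "norm (L y) \<le> t * (y \<bullet> e)" "0 \<le> y \<bullet> e"
    and ab: "0 \<le> a" "0 \<le> b"
  show "0 \<le> (a *\<^sub>R x + b *\<^sub>R y) \<bullet> e" using x y ab by (simp add: inner_add_left)
  have "norm (L (a *\<^sub>R x + b *\<^sub>R y)) \<le> a * norm (L x) + b * norm (L y)"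
    using norm_triangle_ineq[of "a *\<^sub>R L x" "b *\<^sub>R L y"] ab
    by (simp add: linear_add[OF linear_L] linear_cmul[OF linear_L])
  also have "\<dots> \<le> a * (t * (x \<bullet> e)) + b * (t * (y \<bullet> e))"
    using x y ab by (intro add_mono mult_left_mono)
  finally show "norm (L (a *\<^sub>R x + b *\<^sub>R y)) \<le> t * ((a *\<^sub>R x + b *\<^sub>R y) \<bullet> e)"
    by (simp add: inner_add_left algebra_simps)
qed

lemma closed_C: "closed C"
  unfolding C_eq by (intro closed_Collect_conj closed_Collect_le continuous_intros continuous_L)

text \<open>At the apex two kinds of normals suffice to show that a displacement orthogonal to all
  of them moves only in unconstrained directions: \<open>- e\<close> kills its scalar part, and a
  normal adapted to the displacement kills its vector part.\<close>

lemma regular_projection_apex: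
  assumes z: "z \<in> C" "z \<bullet> e = 0" and v: "v \<in> rel_interior (normal_cone C z)"
  shows "regular_projection C z v"
proof (rule regular_projection_flat[OF convex_C closed_C z(1) v, of 1])
  have Lz: "L z = 0" using z by (simp add: C_eq)
  fix w assume w: "\<And>u. u \<in> normal_cone C z \<Longrightarrow> w \<bullet> u = 0"
  have "- e \<in> normal_cone C z"
    using z by (auto simp: normal_cone_def C_eq inner_diff_right inner_commute)
  then have we: "w \<bullet> e = 0" using w[of "- e"] by simp
  \<comment> \<open>The multiple of \<open>e\<close> compensates the Cauchy-Schwarz bound on
    \<open>w \<bullet> L c\<close>.\<close>
  have "L w - (t * norm w) *\<^sub>R e \<in> normal_cone C z"
    unfolding normal_cone_def
  proof safe
    fix c assume c: "c \<in> C"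
    have "L w \<bullet> (c - z) = w \<bullet> L c"
      by (simp add: self_adjoint linear_diff[OF linear_L] Lz)
    also have "\<dots> \<le> norm w * norm (L c)" by (rule norm_cauchy_schwarz)
    also have "\<dots> \<le> norm w * (t * (c \<bullet> e))" using c by (intro mult_left_mono) (auto simp: C_eq)
    finally show "(L w - (t * norm w) *\<^sub>R e) \<bullet> (c - z) \<le> 0"
      using z(2) by (simp add: inner_diff_left inner_diff_right inner_commute[of e] algebra_simps)
  qed
  then have "w \<bullet> L w = 0"
    using w[of "L w - (t * norm w) *\<^sub>R e"] we by (simp add: inner_diff_right)
  then have "L w = 0" by (simp add: L_orthogonal)
  then show "z + w \<in> C"
    using we z Lz by (simp add: C_eq linear_add[OF linear_L] inner_add_left)
qed simp

text \<open>For \<open>t = 0\<close> the cone degenerates to a half-line times the free directions,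
  and every vector in the image of \<open>L\<close> is a normal. The radius
  \<open>z \<bullet> e\<close> keeps the scalar coordinate nonnegative.\<close>

lemma regular_projection_ray:
  assumes z: "z \<in> C" "0 < z \<bullet> e" "t = 0" and v: "v \<in> rel_interior (normal_cone C z)"
  shows "regular_projection C z v"
proof (rule regular_projection_flat[OF convex_C closed_C z(1) v z(2)])
  have Lz: "L z = 0" using z by (simp add: C_eq)
  fix w assume w: "\<And>u. u \<in> normal_cone C z \<Longrightarrow> w \<bullet> u = 0" and small: "norm w < z \<bullet> e"
  have "L w \<in> normal_cone C z"
    using z(3) Lz by (auto simp: normal_cone_def C_eq self_adjoint linear_diff[OF linear_L])
  then have "L w = 0" using w[of "L w"] by (simp add: L_orthogonal)
  moreover have "\<bar>w \<bullet> e\<bar> \<le> norm w"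
    using Cauchy_Schwarz_ineq2[of w e] e(1) by simp
  ultimately show "z + w \<in> C"
    using small z(3) Lz by (simp add: C_eq linear_add[OF linear_L] inner_add_left)
qed

lemma regular_projection_interior:
  assumes z: "z \<in> C" "0 < z \<bullet> e" "norm (L z) < t * (z \<bullet> e)"
    and v: "v \<in> rel_interior (normal_cone C z)"
  shows "regular_projection C z v"
proof -
  have "open {x. norm (L x) < t * (x \<bullet> e) \<and> 0 < x \<bullet> e}"
    by (intro open_Collect_conj open_Collect_less continuous_intros continuous_L)
  then obtain r where r: "r > 0" "ball z r \<subseteq> {x. norm (L x) < t * (x \<bullet> e) \<and> 0 < x \<bullet> e}"
    using z by (auto simp: open_contains_ball)
  show ?thesis
  proof (rule regular_projection_flat[OF convex_C closed_C z(1) v r(1)])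
    fix w :: "real^'n" assume "norm w < r"
    then have "z + w \<in> ball z r" by (simp add: dist_norm)
    then show "z + w \<in> C" using r(2) by (auto simp: C_eq)
  qed
qed

text \<open>Here \<open>L z\<close> is nonzero, so the norm is smooth nearby and one constraint
  describes the cone. Its slope along \<open>e\<close> is \<open>- t\<close>, hence its gradient is
  nonzero and alone forms an independent family.\<close>

lemma regular_projection_boundary:
  assumes z: "z \<in> C" "0 < z \<bullet> e" "norm (L z) = t * (z \<bullet> e)" "0 < t"
    and v: "v \<in> rel_interior (normal_cone C z)"
  shows "regular_projection C z v"
proof -
  define S where "S = {x. L x \<noteq> 0 \<and> 0 < x \<bullet> e}"
  define \<phi> where "\<phi> x = norm (L x) - t * (x \<bullet> e)" for x
  have S: "open S"
    unfolding S_def by (intro open_Collect_conj open_Collect_neq open_Collect_less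
        continuous_intros continuous_L)
  have "0 < t * (z \<bullet> e)" using z(2,4) by simp
  then have zS: "z \<in> S" using z(2,3) by (auto simp: S_def)
  have smooth: "smooth_on S \<phi>"
    unfolding smooth_on_def \<phi>_def[abs_def]
  proof
    fix k
    have "ck_on k S (\<lambda>x. norm (L x))"
      by (rule ck_on_compose[OF S _ ck_on_linear[OF bounded_linear_L S] ck_on_norm[of "- {0}"]])
        (auto simp: S_def)
    then show "ck_on k S (\<lambda>x. norm (L x) - t * (x \<bullet> e))"
      by (intro ck_on_diff ck_on_mult ck_on_inner ck_on_const ck_on_ident S)
  qed
  have conv: "convex_on UNIV \<phi>"
  proof (rule convex_onI)
    fix s x y assume s: "0 < (s::real)" "s < 1"
    have "norm (L ((1 - s) *\<^sub>R x + s *\<^sub>R y)) \<le> (1 - s) * norm (L x) + s * norm (L y)"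
      using norm_triangle_ineq[of "(1 - s) *\<^sub>R L x" "s *\<^sub>R L y"] s
      by (simp add: linear_add[OF linear_L] linear_cmul[OF linear_L])
    then show "\<phi> ((1 - s) *\<^sub>R x + s *\<^sub>R y) \<le> (1 - s) * \<phi> x + s * \<phi> y"
      by (simp add: \<phi>_def inner_add_left algebra_simps)
  qed simp
  have "gradient \<phi> z \<bullet> e = - t"
  proof (rule DERIV_unique)
    show "((\<lambda>s. \<phi> (z + s *\<^sub>R e)) has_real_derivative gradient \<phi> z \<bullet> e) (at 0)"
      by (rule has_real_derivative_along_line[OF smooth_on_differentiable[OF smooth zS]])
    have "e \<bullet> e = 1" using e(1) by (simp add: norm_eq_1)
    then have "\<phi> (z + s *\<^sub>R e) = \<phi> z - t * s" for s
      by (simp add: \<phi>_def linear_add[OF linear_L] linear_cmul[OF linear_L] e(2) inner_add_left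
          algebra_simps)
    then show "((\<lambda>s. \<phi> (z + s *\<^sub>R e)) has_real_derivative - t) (at 0)"
      by (auto intro!: derivative_eq_intros)
  qed
  then have nz: "gradient \<phi> z \<noteq> 0" using z(4) by auto
  show ?thesis
    by (rule regular_projection_smooth_constraints[where A = "{()}" and \<phi> = "\<lambda>_. \<phi>" and S = S])
      (use convex_C closed_C z zS S smooth conv nz v in \<open>auto simp: C_eq \<phi>_def S_def\<close>)
qed

lemma regular_projection_cone:
  assumes z: "z \<in> C" and v: "v \<in> rel_interior (normal_cone C z)"
  shows "regular_projection C z v"
proof -
  have "norm (L z) \<le> t * (z \<bullet> e)" "0 \<le> z \<bullet> e" using z by (auto simp: C_eq)
  then consider "z \<bullet> e = 0" | "0 < z \<bullet> e" "t = 0" | "0 < z \<bullet> e" "norm (L z) < t * (z \<bullet> e)"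
    | "0 < z \<bullet> e" "norm (L z) = t * (z \<bullet> e)" "0 < t"
    using t by linarith
  then show ?thesis
    using regular_projection_apex regular_projection_ray regular_projection_interior
      regular_projection_boundary z v by cases blast+
qed

end

section \<open>Products of sets over orthogonal blocks\<close>

text \<open>A resolution of the identity into mutually orthogonal projectors; each block is an image
  of one of them inside the common space.\<close>

locale orthogonal_blocks =
  fixes I :: "'k set" and B :: "'k \<Rightarrow> real^'n::finite \<Rightarrow> real^'n"
  assumes finite_I: "finite I"
    and linear_B: "\<And>k. linear (B k)"
    and self_adjoint: "\<And>k x y. B k x \<bullet> y = x \<bullet> B k y"
    and idem: "\<And>k x. B k (B k x) = B k x"
    and orth: "\<And>k l x. k \<in> I \<Longrightarrow> l \<in> I \<Longrightarrow> k \<noteq> l \<Longrightarrow> B k (B l x) = 0"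
    and sum_B: "\<And>x. (\<Sum>k\<in>I. B k x) = x"
begin

lemma bounded_linear_B: "bounded_linear (B k)"
  using linear_B by (simp add: linear_conv_bounded_linear)

lemmas B_linear = linear_add[OF linear_B] linear_diff[OF linear_B] linear_0[OF linear_B]
  linear_neg[OF linear_B]

lemma B_B_inner: "B k x \<bullet> B k y = B k x \<bullet> y"
  by (simp add: self_adjoint idem)

lemma inner_blocks: "x \<bullet> y = (\<Sum>k\<in>I. B k x \<bullet> B k y)"
proof -
  have "x \<bullet> y = (\<Sum>k\<in>I. B k x) \<bullet> y" by (simp only: sum_B)
  then show ?thesis by (simp add: inner_sum_left B_B_inner)
qed

lemma B_sum:
  assumes "l \<in> I"
  shows "B l (\<Sum>k\<in>I. B k (f k)) = B l (f l)"
proof -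
  have "B l (\<Sum>k\<in>I. B k (f k)) = (\<Sum>k\<in>I. if k = l then B l (f l) else 0)"
    unfolding linear_sum[OF linear_B] using orth assms by (intro sum.cong) (auto simp: idem)
  then show ?thesis using assms finite_I by simp
qed

text \<open>The factor with the coordinates of all other blocks left free. The product is then an
  intersection of cylinders, and constraints composed with the block projector describe a cylinder
  exactly.\<close>

definition cylinder :: "('k \<Rightarrow> (real^'n) set) \<Rightarrow> 'k \<Rightarrow> (real^'n) set" where
  "cylinder Dk k = {x. B k x \<in> Dk k}"

definition block_product :: "('k \<Rightarrow> (real^'n) set) \<Rightarrow> (real^'n) set" where
  "block_product Dk = {x. \<forall>k\<in>I. B k x \<in> Dk k}"

lemma block_product_eq: "block_product Dk = (\<Inter>k\<in>I. cylinder Dk k)"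
  by (auto simp: block_product_def cylinder_def)

lemma normal_cone_cylinder_subset:
  assumes "k \<in> I"
  shows "normal_cone (cylinder Dk k) (B k z) \<subseteq> normal_cone (block_product Dk) z"
proof
  fix u assume u: "u \<in> normal_cone (cylinder Dk k) (B k z)"
  show "u \<in> normal_cone (block_product Dk) z"
    unfolding normal_cone_def
  proof safe
    fix c assume "c \<in> block_product Dk"
    then have "B k z + (c - z) \<in> cylinder Dk k"
      using assms by (simp add: block_product_def cylinder_def B_linear idem)
    then show "u \<bullet> (c - z) \<le> 0"
      using u by (force simp: normal_cone_def)
  qed
qed

text \<open>The part of \<open>u\<close> outside the block is a free direction, so moving along it
  stays in the cylinder and the normal inequality forces that part to vanish.\<close>

lemma cylinder_normal:
  assumes "x \<in> cylinder Dk k" "u \<in> normal_cone (cylinder Dk k) x"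
  shows "B k u = u"
proof -
  let ?u = "u - B k u"
  have "x + ?u \<in> cylinder Dk k"
    using assms(1) by (simp add: cylinder_def B_linear idem)
  then have "u \<bullet> ?u \<le> 0" using assms(2) by (force simp: normal_cone_def)
  moreover have "B k u \<bullet> ?u = 0" by (simp add: self_adjoint B_linear idem)
  ultimately have "?u \<bullet> ?u \<le> 0" by (simp add: inner_diff_left)
  then show ?thesis by (metis dual_order.antisym eq_iff_diff_eq_0 inner_eq_zero_iff inner_ge_zero)
qed

text \<open>As a linear image of the normal cone of the product, the factor's cone inherits relative
  interior points; this carries strict complementarity to each block.\<close>

lemma normal_cone_cylinder:
  assumes k: "k \<in> I" and z: "z \<in> block_product Dk"
  shows "B k ` normal_cone (block_product Dk) z = normal_cone (cylinder Dk k) (B k z)"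
proof
  have Bz: "B k z \<in> cylinder Dk k"
    using k z by (simp add: block_product_def cylinder_def idem)
  show "normal_cone (cylinder Dk k) (B k z) \<subseteq> B k ` normal_cone (block_product Dk) z"
  proof
    fix u assume u: "u \<in> normal_cone (cylinder Dk k) (B k z)"
    show "u \<in> B k ` normal_cone (block_product Dk) z"
      using cylinder_normal[OF Bz u] subsetD[OF normal_cone_cylinder_subset[OF k] u]
      by (intro image_eqI[of u "B k" u]) simp_all
  qed
  show "B k ` normal_cone (block_product Dk) z \<subseteq> normal_cone (cylinder Dk k) (B k z)"
  proof safe
    fix w assume w: "w \<in> normal_cone (block_product Dk) z"
    show "B k w \<in> normal_cone (cylinder Dk k) (B k z)"
      unfolding normal_cone_def
    proof safe
      fix c assume c: "c \<in> cylinder Dk k"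
      \<comment> \<open>Replacing only block \<open>k\<close> of \<open>z\<close> by that of
        \<open>c\<close> gives a point of the product.\<close>
      have "B l (z + B k (c - z)) \<in> Dk l" if l: "l \<in> I" for l
        using c z l k orth[of l k "c - z"]
        by (cases "l = k") (simp_all add: B_linear idem cylinder_def block_product_def)
      then have "z + B k (c - z) \<in> block_product Dk" by (simp add: block_product_def)
      then have "w \<bullet> B k (c - z) \<le> 0" using w by (force simp: normal_cone_def)
      then show "B k w \<bullet> (c - B k z) \<le> 0"
        by (simp add: self_adjoint B_linear idem)
    qed
  qed
qed

lemma rel_interior_normal_cone_cylinder:
  assumes "k \<in> I" "z \<in> block_product Dk"
    and "v \<in> rel_interior (normal_cone (block_product Dk) z)"
  shows "B k v \<in> rel_interior (normal_cone (cylinder Dk k) (B k z))"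
proof -
  have "B k v \<in> B k ` rel_interior (normal_cone (block_product Dk) z)"
    using assms(3) by (rule imageI)
  then show ?thesis
    unfolding rel_interior_convex_linear_image[OF linear_B convex_normal_cone]
      normal_cone_cylinder[OF assms(1,2)] .
qed

text \<open>The obtuse-angle inequality for the assembled point is a sum of the inequalities for the
  factors.\<close>

lemma closest_point_block_product:
  assumes C: "\<And>k. k \<in> I \<Longrightarrow> convex (cylinder Dk k)" "\<And>k. k \<in> I \<Longrightarrow> closed (cylinder Dk k)"
    and ne: "\<And>k. k \<in> I \<Longrightarrow> cylinder Dk k \<noteq> {}"
  shows "closest_point (block_product Dk) y
    = (\<Sum>k\<in>I. B k (closest_point (cylinder Dk k) (B k y)))"
proof (rule closest_point_normal_cone)
  let ?c = "\<lambda>k. closest_point (cylinder Dk k) (B k y)"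
  let ?x = "\<Sum>k\<in>I. B k (?c k)"
  show "convex (block_product Dk)" "closed (block_product Dk)"
    unfolding block_product_eq using C by (auto intro: convex_INT)
  have c: "?c k \<in> cylinder Dk k" if "k \<in> I" for k
    by (rule closest_point_in_set[OF C(2)[OF that] ne[OF that]])
  have Bx: "B k ?x = B k (?c k)" if "k \<in> I" for k by (rule B_sum[OF that])
  show "?x \<in> block_product Dk"
    unfolding block_product_def mem_Collect_eq
  proof
    show "B k ?x \<in> Dk k" if "k \<in> I" for k
      unfolding Bx[OF that] using c[OF that] by (simp add: cylinder_def)
  qed
  show "y - ?x \<in> normal_cone (block_product Dk) ?x"
    unfolding normal_cone_def
  proof safe
    fix d assume d: "d \<in> block_product Dk"
    have "B k (y - ?x) \<bullet> B k (d - ?x) \<le> 0" if k: "k \<in> I" for k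
    proof -
      have "?c k + B k (d - ?c k) \<in> cylinder Dk k"
        using d k by (simp add: cylinder_def block_product_def B_linear idem)
      then have "(B k y - ?c k) \<bullet> B k (d - ?c k) \<le> 0"
        using diff_closest_point_normal_cone[OF C(1)[OF k] C(2)[OF k], of "B k y"]
        by (force simp: normal_cone_def)
      also have "(B k y - ?c k) \<bullet> B k (d - ?c k) = B k (B k y - ?c k) \<bullet> B k (d - ?c k)"
        by (simp add: self_adjoint idem)
      also have "\<dots> = B k (y - ?x) \<bullet> B k (d - ?x)"
        unfolding linear_diff[OF linear_B] Bx[OF k] by (simp add: idem)
      finally show ?thesis .
    qed
    then show "(y - ?x) \<bullet> (d - ?x) \<le> 0"
      unfolding inner_blocks[of "y - ?x"] by (rule sum_nonpos)
  qed
qed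

text \<open>The derivative acts blockwise, so a kernel element has each component in the kernel of
  the factor's derivative, and normals of the factors are normals of the product.\<close>

lemma regular_projection_block_product:
  assumes C: "\<And>k. k \<in> I \<Longrightarrow> convex (cylinder Dk k)" "\<And>k. k \<in> I \<Longrightarrow> closed (cylinder Dk k)"
    and z: "z \<in> block_product Dk"
    and reg: "\<And>k. k \<in> I \<Longrightarrow> regular_projection (cylinder Dk k) (B k z) (B k v)"
  shows "regular_projection (block_product Dk) z v"
proof -
  let ?\<pi> = "\<lambda>k. closest_point (cylinder Dk k)"
  have mem: "B k z \<in> cylinder Dk k" if "k \<in> I" for k
    using z that by (simp add: block_product_def cylinder_def idem)
  then have ne: "cylinder Dk k \<noteq> {}" if "k \<in> I" for k using that by blast
  note cp = closest_point_block_product[of Dk, OF C ne]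
  obtain V where V: "\<And>k. k \<in> I \<Longrightarrow> open (V k)" "\<And>k. k \<in> I \<Longrightarrow> B k (z + v) \<in> V k"
      "\<And>k. k \<in> I \<Longrightarrow> smooth_on (V k) (?\<pi> k)"
    using reg unfolding regular_projection_def B_linear by metis
  define W where "W = (\<Inter>k\<in>I. B k -` V k)"
  have W: "open W"
    unfolding W_def using finite_I V(1)
    by (intro open_INT ballI open_vimage linear_continuous_on[OF bounded_linear_B]) auto
  have zW: "z + v \<in> W" using V(2) by (simp add: W_def)
  have ckW: "ck_on j W (\<lambda>y. \<Sum>k\<in>I. B k (?\<pi> k (B k y)))" for j
  proof (rule ck_on_sum[OF W])
    fix k assume k: "k \<in> I"
    have "ck_on j W (\<lambda>y. ?\<pi> k (B k y))"
      by (rule ck_on_compose[OF W _ ck_on_linear[OF bounded_linear_B W] smooth_on_ck[OF V(3)[OF k]]])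
        (use k in \<open>auto simp: W_def\<close>)
    then show "ck_on j W (\<lambda>y. B k (?\<pi> k (B k y)))"
      by (rule ck_on_bounded_linear[OF bounded_linear_B W])
  qed
  have smooth: "smooth_on W (closest_point (block_product Dk))"
    unfolding smooth_on_def using ck_on_cong[OF ckW W cp[symmetric]] by blast
  let ?D = "\<lambda>k. frechet_derivative (?\<pi> k) (at (B k (z + v)))"
  have D: "(?\<pi> k has_derivative ?D k) (at (B k (z + v)))" if "k \<in> I" for k
    using smooth_on_differentiable[OF V(3)[OF that] V(2)[OF that]]
    by (simp add: frechet_derivative_works)
  have DB: "((\<lambda>y. ?\<pi> k (B k y)) has_derivative (\<lambda>d. ?D k (B k d))) (at (z + v))" if "k \<in> I" for k
    using diff_chain_at[OF bounded_linear.has_derivative[OF bounded_linear_B has_derivative_ident]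
        D[OF that]] by (simp add: o_def)
  have "((\<lambda>y. \<Sum>k\<in>I. B k (?\<pi> k (B k y))) has_derivative (\<lambda>d. \<Sum>k\<in>I. B k (?D k (B k d))))
      (at (z + v))"
    by (intro has_derivative_sum bounded_linear.has_derivative[OF bounded_linear_B] DB)
  then have "(closest_point (block_product Dk) has_derivative (\<lambda>d. \<Sum>k\<in>I. B k (?D k (B k d))))
      (at (z + v))"
    by (simp only: cp[symmetric])
  note D_prod = frechet_derivative_at[OF this, symmetric]
  \<comment> \<open>The derivative of the product controls only the \<open>k\<close>-th part of the
    factor's derivative. Projecting a vector of the block space stays in that space, so there is no
    other part.\<close>
  have off_block: "?\<pi> k (B k y) = B k (?\<pi> k (B k y))" if k: "k \<in> I" for k y
  proof -
    have "B k (B k y - ?\<pi> k (B k y)) = B k y - ?\<pi> k (B k y)"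
      using closest_point_in_set[OF C(2)[OF k] ne[OF k]]
      by (rule cylinder_normal[OF _ diff_closest_point_normal_cone[OF C(1)[OF k] C(2)[OF k]]])
    then show ?thesis by (simp add: B_linear idem)
  qed
  have "d \<in> span (normal_cone (block_product Dk) z)"
    if d: "frechet_derivative (closest_point (block_product Dk)) (at (z + v)) d = 0" for d
  proof -
    have "B k d \<in> span (normal_cone (block_product Dk) z)" if k: "k \<in> I" for k
    proof -
      have "((\<lambda>y. B k (?\<pi> k (B k y))) has_derivative (\<lambda>d. B k (?D k (B k d)))) (at (z + v))"
        by (rule bounded_linear.has_derivative[OF bounded_linear_B DB[OF k]])
      then have "((\<lambda>y. ?\<pi> k (B k y)) has_derivative (\<lambda>d. B k (?D k (B k d)))) (at (z + v))"
        by (simp only: off_block[OF k, symmetric])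
      from has_derivative_unique[OF DB[OF k] this]
      have "?D k (B k d) = B k (?D k (B k d))" by (rule fun_cong)
      moreover have "B k (?D k (B k d)) = 0"
        using arg_cong[OF d, of "B k"] unfolding D_prod B_sum[OF k] B_linear .
      ultimately have "?D k (B k d) = 0" by simp
      then have "B k d \<in> span (normal_cone (cylinder Dk k) (B k z))"
        using reg[OF k] unfolding regular_projection_def B_linear by blast
      then show ?thesis
        using span_mono[OF normal_cone_cylinder_subset[OF k]] by blast
    qed
    then have "(\<Sum>k\<in>I. B k d) \<in> span (normal_cone (block_product Dk) z)"
      by (rule span_sum)
    then show ?thesis by (simp only: sum_B)
  qed
  then show ?thesis
    unfolding regular_projection_def using W zW smooth by blast
qed

end

section \<open>The blocks of the primal variable\<close>

lemma block_part_nth: "block_part zc i j x $ c = (if in_block zc i j c then x $ c else 0)"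
  by (simp add: block_part_def)

lemma linear_block_part: "linear (block_part zc i j)"
  by (rule linearI) (auto simp: block_part_nth vec_eq_iff)

lemma block_part_in_block_space [simp]: "block_part zc i j x \<in> block_space zc i j"
  by (simp add: block_space_def block_part_nth)

lemma block_part_self_adjoint: "block_part zc i j x \<bullet> y = x \<bullet> block_part zc i j y"
  unfolding inner_vec_def by (intro sum.cong) (auto simp: block_part_nth)

lemma orthogonal_blocks_block_part:
  fixes zc :: "'z::finite \<Rightarrow> nat \<times> nat \<times> nat"
  assumes "bij_betw zc UNIV (z_positions N m n)"
  shows "orthogonal_blocks (SIGMA i:{0..N+1}. {1..m i}) (\<lambda>k. block_part zc (fst k) (snd k))"
proof
  let ?I = "SIGMA i:{0..N+1}. {1..m i}"
  fix x :: "real^'z"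
  show "(\<Sum>k\<in>?I. block_part zc (fst k) (snd k) x) = x"
    unfolding vec_eq_iff
  proof
    fix c
    have "zc c \<in> z_positions N m n" using assms by (auto simp: bij_betw_def)
    then have mem: "(fst (zc c), fst (snd (zc c))) \<in> ?I" by (auto simp: z_positions_def)
    have "(\<Sum>k\<in>?I. block_part zc (fst k) (snd k) x) $ c
        = (\<Sum>k\<in>?I. if k = (fst (zc c), fst (snd (zc c))) then x $ c else 0)"
      unfolding sum_component by (rule sum.cong) (auto simp: block_part_nth in_block_def)
    also have "\<dots> = x $ c" using mem by (simp only: sum.delta finite_SigmaI finite_atLeastAtMost if_True)
    finally show "(\<Sum>k\<in>?I. block_part zc (fst k) (snd k) x) $ c = x $ c" .
  qed
qed (auto simp: linear_block_part block_part_self_adjoint block_part_nth vec_eq_iff in_block_def)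

abbreviation block_cylinder ::
    "('z::finite \<Rightarrow> nat \<times> nat \<times> nat) \<Rightarrow> nat \<Rightarrow> nat \<Rightarrow> (real^'z) set \<Rightarrow> (real^'z) set" where
  "block_cylinder zc i j S \<equiv> {x. block_part zc i j x \<in> S}"

lemma affine_block_cylinder: "affine S \<Longrightarrow> affine (block_cylinder zc i j S)"
  unfolding affine_def
  by (simp add: linear_add[OF linear_block_part] linear_cmul[OF linear_block_part])

lemma cone_cylinder_block:
  fixes zc :: "'z::finite \<Rightarrow> nat \<times> nat \<times> nat"
  assumes "is_second_order_cone zc n i j S"
  obtains L e t where "cone_cylinder L e t (block_cylinder zc i j S)"
proof -
  obtain c t where c: "zc c = (i, j, n i j)" and t: "0 \<le> t"
    and S: "S = {x \<in> block_space zc i j. norm (x - axis c (x $ c)) \<le> t * x $ c \<and> 0 \<le> x $ c}"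
    using assms by (auto simp: is_second_order_cone_def)
  have in_c: "in_block zc i j c" using c by (simp add: in_block_def)
  define L where "L x = block_part zc i j x - axis c (x $ c)" for x :: "real^'z"
  have L_nth: "L x $ d = (if in_block zc i j d \<and> d \<noteq> c then x $ d else 0)" for x d
    using in_c by (auto simp: L_def block_part_nth axis_def)
  have "cone_cylinder L (axis c 1) t (block_cylinder zc i j S)"
  proof (rule cone_cylinder.intro)
    show "linear L" by (rule linearI) (auto simp: L_nth vec_eq_iff)
    show "L x \<bullet> y = x \<bullet> L y" for x y
      unfolding inner_vec_def by (intro sum.cong) (auto simp: L_nth)
    show "block_cylinder zc i j S
        = {x. norm (L x) \<le> t * (x \<bullet> axis c 1) \<and> 0 \<le> x \<bullet> axis c 1}"
      by (auto simp: S L_def block_part_nth in_c inner_axis)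
    show "L (L x) = L x" for x by (simp add: L_nth vec_eq_iff)
    show "L (axis c 1) = 0" by (simp add: L_nth vec_eq_iff axis_def)
    show "norm (axis c 1 :: real^'z) = 1" by (simp add: norm_axis_1)
    show "0 \<le> t" by (rule t)
  qed
  then show ?thesis using that by blast
qed

lemma block_cylinder_smooth_constraints:
  fixes zc :: "'z::finite \<Rightarrow> nat \<times> nat \<times> nat"
  assumes "smooth_independent_constraints zc p \<Phi> i j"
  shows "closed (block_cylinder zc i j (block_set zc p \<Phi> i j))"
    and "convex (block_cylinder zc i j (block_set zc p \<Phi> i j)) \<Longrightarrow> x \<in> block_set zc p \<Phi> i j \<Longrightarrow>
      v \<in> rel_interior (normal_cone (block_cylinder zc i j (block_set zc p \<Phi> i j)) x) \<Longrightarrow>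
      regular_projection (block_cylinder zc i j (block_set zc p \<Phi> i j)) x v"
proof -
  let ?C = "block_cylinder zc i j (block_set zc p \<Phi> i j)"
  let ?L = "{1..p i j}"
  define f where "f l z = \<Phi> i j l (block_part zc i j z)" for l z
  have C_eq: "?C = {x. \<forall>l\<in>?L. f l x \<le> 0}"
    by (simp add: block_set_def f_def)
  have smooth: "smooth_on UNIV (f l)" if "l \<in> ?L" for l
    using assms that by (simp add: smooth_independent_constraints_def f_def[abs_def])
  have cont: "continuous_on UNIV (f l)" if "l \<in> ?L" for l
    using smooth_on_continuous[OF smooth[OF that]] .
  have conv: "convex_on UNIV (f l)" if "l \<in> ?L" for l
  proof (rule convex_onI)
    have c: "convex_on (block_space zc i j) (\<Phi> i j l)"
      using assms that by (simp add: smooth_independent_constraints_def)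
    show "f l ((1 - t) *\<^sub>R x + t *\<^sub>R y) \<le> (1 - t) * f l x + t * f l y" if "0 < t" "t < 1" for t x y
      using convex_onD[OF c, of t "block_part zc i j x" "block_part zc i j y"] that
      by (simp add: f_def linear_add[OF linear_block_part] linear_cmul[OF linear_block_part])
  qed simp
  have "?C = (\<Inter>l\<in>?L. {x. f l x \<le> 0})" unfolding C_eq by blast
  also have "closed \<dots>"
    using cont by (intro closed_INT ballI closed_Collect_le) auto
  finally show closed: "closed ?C" .
  assume convC: "convex ?C" and x: "x \<in> block_set zc p \<Phi> i j"
    and v: "v \<in> rel_interior (normal_cone ?C x)"
  have "x \<in> block_space zc i j" using x by (simp add: block_set_def)
  then have bx: "block_part zc i j x = x"
    by (simp add: block_space_def block_part_nth vec_eq_iff)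
  define A where "A = {l \<in> ?L. \<Phi> i j l x = 0}"
  have A: "A = {l \<in> ?L. f l x = 0}" by (simp add: A_def f_def bx)
  have indep: "inj_on (\<lambda>l. gradient (f l) x) A" "independent ((\<lambda>l. gradient (f l) x) ` A)"
    using assms x by (auto simp: smooth_independent_constraints_def f_def[abs_def] A_def Let_def)
  \<comment> \<open>The constraints inactive at \<open>x\<close> remain strict on \<open>S\<close>,
    so only the active ones describe the set there.\<close>
  define S where "S = (\<Inter>l\<in>?L - A. {y. f l y < 0})"
  have S: "open S"
    unfolding S_def using cont by (intro open_INT ballI open_Collect_less) auto
  have xC: "x \<in> ?C" using x bx by simp
  show "regular_projection ?C x v"
  proof (rule regular_projection_smooth_constraints[OF convC closed xC S _ _ _ _ _ _ _ indep v])
    show "x \<in> S" using xC unfolding C_eq S_def A by force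
    show "smooth_on S (f l)" if "l \<in> A" for l
      using smooth_on_subset[OF smooth] that by (auto simp: A)
    show "y \<in> ?C" if "y \<in> S" "\<And>l. l \<in> A \<Longrightarrow> f l y \<le> 0" for y
      unfolding C_eq
    proof safe
      fix l assume "l \<in> ?L"
      then show "f l y \<le> 0" using that by (cases "l \<in> A") (auto simp: S_def intro: less_imp_le)
    qed
  qed (use conv in \<open>auto simp: A C_eq simp del: atLeastAtMost_iff\<close>)
qed


section \<open>The dual cone\<close>

lemma convex_polar_K: "convex (polar_K E)"
  by (rule convexI) (auto simp: polar_K_def intro!: add_nonpos_nonpos mult_nonneg_nonpos)

lemma closed_polar_K: "closed (polar_K E)"
proof -
  have "polar_K E = (\<Inter>r\<in>- E. {v. v $ r \<le> 0})" by (auto simp: polar_K_def)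
  then show ?thesis by (auto intro!: closed_INT closed_Collect_le continuous_intros)
qed

lemma axis_in_normal_cone_polar_K:
  assumes "r \<notin> E" "w $ r = 0"
  shows "axis r 1 \<in> normal_cone (polar_K E) w"
  using assms by (auto simp: normal_cone_def polar_K_def inner_axis inner_commute[of "axis r 1"])

text \<open>Sign-constrained coordinates that vanish at \<open>w\<close> have their axes among the
  normals, so an orthogonal displacement leaves them at zero; negative coordinates stay negative
  under small displacements.\<close>

lemma polar_K_flat:
  fixes w :: "real^'w::finite"
  assumes w: "w \<in> polar_K E"
  obtains e where "0 < e"
    "\<And>u. (\<And>v. v \<in> normal_cone (polar_K E) w \<Longrightarrow> u \<bullet> v = 0) \<Longrightarrow> norm u < e \<Longrightarrow> w + u \<in> polar_K E"
proof -
  define S where "S = (\<Inter>r\<in>{r. w $ r < 0}. {x :: real^'w. x $ r < 0})"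
  have "open S" unfolding S_def by (intro open_INT ballI open_Collect_less continuous_intros) auto
  moreover have "w \<in> S" by (simp add: S_def)
  ultimately obtain e where e: "0 < e" "ball w e \<subseteq> S" by (auto simp: open_contains_ball)
  show ?thesis
  proof (rule that[OF e(1)])
    fix u assume u: "\<And>v. v \<in> normal_cone (polar_K E) w \<Longrightarrow> u \<bullet> v = 0" and "norm u < e"
    then have "w + u \<in> ball w e" by (simp add: dist_norm)
    then have wu: "w + u \<in> S" using e(2) by blast
    show "w + u \<in> polar_K E"
      unfolding polar_K_def mem_Collect_eq
    proof (intro allI impI)
      fix r assume r: "r \<notin> E"
      show "(w + u) $ r \<le> 0"
      proof (cases "w $ r = 0")
        case True
        then show ?thesis
          using u[OF axis_in_normal_cone_polar_K[OF r True]] by (simp add: inner_axis)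
      next
        case False
        then have "w $ r < 0" using w r by (force simp: polar_K_def)
        then have "(w + u) $ r < 0" using wu by (simp only: S_def INT_iff mem_Collect_eq)
        then show ?thesis by simp
      qed
    qed
  qed
qed

text \<open>Complementary slackness: a negative coordinate can be both doubled and set to zero
  without leaving the cone, and the two opposite normal inequalities give
  \<open>v $ r * w $ r = 0\<close>.\<close>

lemma normal_cone_polar_K_inactive:
  assumes w: "w \<in> polar_K E" and v: "v \<in> normal_cone (polar_K E) w"
    and r: "r \<notin> E" "v $ r \<noteq> 0"
  shows "w $ r = 0"
proof (rule ccontr)
  assume "w $ r \<noteq> 0"
  then have neg: "w $ r < 0" using w r by (force simp: polar_K_def)
  have "v \<bullet> (s *\<^sub>R axis r (w $ r)) \<le> 0" if "s \<ge> -1" for s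
  proof -
    have "w $ r + s * w $ r = (1 + s) * w $ r" by (simp add: algebra_simps)
    then have "w $ r + s * w $ r \<le> 0" using neg that by (simp add: mult_le_0_iff)
    then have "w + s *\<^sub>R axis r (w $ r) \<in> polar_K E"
      using w by (auto simp: polar_K_def axis_def)
    then show ?thesis using v by (force simp: normal_cone_def)
  qed
  from this[of 1] this[of "-1"] have "v $ r * w $ r = 0" by (simp add: inner_axis)
  then show False using neg r by simp
qed


section \<open>Nonsingularity\<close>

text \<open>Firm nonexpansiveness of the projection, divided by the square of the step and passed to
  the limit.\<close>

lemma closest_point_derivative_firm:
  fixes C :: "'a::euclidean_space set"
  assumes C: "convex C" "closed C" "C \<noteq> {}" and D: "(closest_point C has_derivative D) (at y)"
  shows "D d \<bullet> D d \<le> D d \<bullet> d"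
proof -
  let ?p = "closest_point C"
  have firm: "(?p a - ?p b) \<bullet> (?p a - ?p b) \<le> (?p a - ?p b) \<bullet> (a - b)" for a b
  proof -
    have "(a - ?p a) \<bullet> (?p b - ?p a) \<le> 0" "(b - ?p b) \<bullet> (?p a - ?p b) \<le> 0"
      using C by (auto intro!: closest_point_dot closest_point_in_set)
    then show ?thesis by (simp add: inner_diff_left inner_diff_right inner_commute)
  qed
  have "((\<lambda>t. y + t *\<^sub>R d) has_vector_derivative d) (at 0)"
    by (auto intro!: derivative_eq_intros)
  moreover have "(?p has_derivative D) (at (y + 0 *\<^sub>R d) within range (\<lambda>t. y + t *\<^sub>R d))"
    using has_derivative_at_withinI[OF D] by simp
  ultimately have "((\<lambda>t. ?p (y + t *\<^sub>R d)) has_vector_derivative D d) (at (0::real))"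
    using vector_derivative_diff_chain_within[of "\<lambda>t. y + t *\<^sub>R d" d 0 UNIV ?p D]
    by (simp add: o_def)
  then have "((\<lambda>t. (?p (y + t *\<^sub>R d) - ?p y - t *\<^sub>R D d) /\<^sub>R \<bar>t\<bar>) \<longlongrightarrow> 0) (at (0::real))"
    by (simp add: has_vector_derivative_def has_derivative_at_within)
  then have "((\<lambda>t. norm ((?p (y + t *\<^sub>R d) - ?p y - t *\<^sub>R D d) /\<^sub>R \<bar>t\<bar>)) \<longlongrightarrow> 0) (at (0::real))"
    by (rule tendsto_norm_zero)
  \<comment> \<open>The derivative is defined with division by \<open>\<bar>t\<bar>\<close>; under
    the norm this may be replaced by \<open>t\<close>, which gives the usual difference quotient
    from both sides.\<close>
  moreover have "\<forall>\<^sub>F t in at (0::real). norm ((?p (y + t *\<^sub>R d) - ?p y - t *\<^sub>R D d) /\<^sub>R \<bar>t\<bar>)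
      = norm ((?p (y + t *\<^sub>R d) - ?p y) /\<^sub>R t - D d)"
    unfolding eventually_at_filter
  proof (intro always_eventually allI impI)
    fix t :: real assume "t \<noteq> 0"
    then have "(?p (y + t *\<^sub>R d) - ?p y) /\<^sub>R t - D d = (?p (y + t *\<^sub>R d) - ?p y - t *\<^sub>R D d) /\<^sub>R t"
      by (simp add: scaleR_diff_right)
    then show "norm ((?p (y + t *\<^sub>R d) - ?p y - t *\<^sub>R D d) /\<^sub>R \<bar>t\<bar>)
        = norm ((?p (y + t *\<^sub>R d) - ?p y) /\<^sub>R t - D d)"
      by simp
  qed
  ultimately have "((\<lambda>t. norm ((?p (y + t *\<^sub>R d) - ?p y) /\<^sub>R t - D d)) \<longlongrightarrow> 0) (at (0::real))"
    by (rule Lim_transform_eventually)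
  then have lim: "((\<lambda>t. (?p (y + t *\<^sub>R d) - ?p y) /\<^sub>R t) \<longlongrightarrow> D d) (at (0::real))"
    by (rule LIM_zero_cancel[OF tendsto_norm_zero_cancel])
  show ?thesis
  proof (rule tendsto_le[OF _ tendsto_inner[OF lim tendsto_const] tendsto_inner[OF lim lim]])
    show "\<forall>\<^sub>F t in at (0::real). ((?p (y + t *\<^sub>R d) - ?p y) /\<^sub>R t) \<bullet> ((?p (y + t *\<^sub>R d) - ?p y) /\<^sub>R t)
        \<le> ((?p (y + t *\<^sub>R d) - ?p y) /\<^sub>R t) \<bullet> d"
      unfolding eventually_at_filter
    proof (intro always_eventually allI impI)
      fix t :: real assume t: "t \<noteq> 0"
      let ?\<delta> = "?p (y + t *\<^sub>R d) - ?p y"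
      have "?\<delta> \<bullet> ?\<delta> \<le> t * (?\<delta> \<bullet> d)" using firm[of "y + t *\<^sub>R d" y] by simp
      then have "inverse t ^ 2 * (?\<delta> \<bullet> ?\<delta>) \<le> inverse t ^ 2 * (t * (?\<delta> \<bullet> d))"
        by (rule mult_left_mono) simp
      also have "\<dots> = inverse t * (?\<delta> \<bullet> d)" using t by (simp add: power2_eq_square)
      finally show "(?\<delta> /\<^sub>R t) \<bullet> (?\<delta> /\<^sub>R t) \<le> (?\<delta> /\<^sub>R t) \<bullet> d"
        by (simp add: power2_eq_square mult.assoc)
    qed
  qed simp
qed

lemma selected_transpose_mult:
  assumes "\<And>r. r \<notin> S \<Longrightarrow> u $ r = 0"
  shows "selected_transpose H S *v u = transpose H *v u"
  using assms
  by (auto simp: vec_eq_iff selected_transpose_def transpose_def matrix_vector_mult_def intro!: sum.cong)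

text \<open>A kernel vector with nonzero entry \<open>r\<close> makes column \<open>r\<close> a
  combination of the other columns in \<open>S\<close>, so the rank drops below
  \<open>card S\<close>.\<close>

lemma full_column_rank_injective:
  fixes H :: "real^'z^'w::finite"
  assumes rank: "rank (selected_transpose H S) = card S"
    and supp: "\<And>r. r \<notin> S \<Longrightarrow> u $ r = 0" and zero: "selected_transpose H S *v u = 0"
  shows "u = 0"
proof (rule ccontr)
  let ?M = "selected_transpose H S"
  assume "u \<noteq> 0"
  then obtain r where r: "u $ r \<noteq> 0" by (auto simp: vec_eq_iff)
  then have rS: "r \<in> S" using supp by blast
  have "?M *v x \<in> span ((\<lambda>s. column s ?M) ` (S - {r}))" for x
  proof -
    \<comment> \<open>Subtracting a multiple of the kernel vector clears entry \<open>r\<close>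
      without changing the image.\<close>
    define y where "y = x - (x $ r / u $ r) *\<^sub>R u"
    have "?M *v x = ?M *v y"
      by (simp add: y_def matrix_vector_mult_diff_distrib matrix_vector_mult_scaleR zero)
    also have "\<dots> = (\<Sum>s\<in>UNIV. y $ s *\<^sub>R column s ?M)"
      by (simp add: matrix_mult_sum scalar_mult_eq_scaleR)
    also have "\<dots> \<in> span ((\<lambda>s. column s ?M) ` (S - {r}))"
    proof (rule span_sum)
      fix s
      show "y $ s *\<^sub>R column s ?M \<in> span ((\<lambda>s. column s ?M) ` (S - {r}))"
      proof (cases "s \<in> S - {r}")
        case True
        then show ?thesis by (intro span_scale span_base) auto
      next
        case False
        have "y $ r = 0" using r by (simp add: y_def)
        moreover have "column s ?M = 0" if "s \<notin> S"
          using that by (simp add: column_def selected_transpose_def vec_eq_iff)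
        ultimately have "y $ s *\<^sub>R column s ?M = 0" using False by auto
        then show ?thesis by (simp only: span_zero)
      qed
    qed
    finally show ?thesis .
  qed
  then have "range ((*v) ?M) \<subseteq> span ((\<lambda>s. column s ?M) ` (S - {r}))" by blast
  then have "dim (range ((*v) ?M)) \<le> card ((\<lambda>s. column s ?M) ` (S - {r}))"
    by (intro dim_le_card) auto
  also have "\<dots> \<le> card (S - {r})" by (rule card_image_le) simp
  also have "\<dots> < card S" using rS by (intro psubset_card_mono) auto
  finally show False using rank by (simp add: rank_dim_range)
qed

text \<open>\<open>JK\<close> enters only as the orthogonal projector along \<open>W\<close>: its
  image is orthogonal to \<open>W\<close> and its residuals lie in \<open>W\<close>. The equation
  for \<open>u\<close> therefore says that \<open>u\<close> is orthogonal to \<open>W\<close> and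
  that \<open>\<beta> *\<^sub>R (H *v x)\<close> belongs to \<open>W\<close>. Since \<open>W\<close>
  contains the axes of the rows outside \<open>S\<close>, \<open>u\<close> is supported on the rows
  entering the LICQ.\<close>

lemma kernel_trivial_at_fixed_point:
  fixes H :: "real^'z::finite^'w::finite" and P :: "real^'z^'z"
    and JD :: "real^'z^'z" and JK :: "real^'w^'w"
  assumes \<alpha>: "0 < \<alpha>" and P: "\<And>x. x \<noteq> 0 \<Longrightarrow> 0 < x \<bullet> (P *v x)"
    and JD_firm: "\<And>d. (JD *v d) \<bullet> (JD *v d) \<le> (JD *v d) \<bullet> d"
    and JD_kernel: "\<And>d. JD *v d = 0 \<Longrightarrow> d \<in> span N"
    and JK_mem: "\<And>x. x - JK *v x \<in> W" and JK_orth: "\<And>x y. y \<in> W \<Longrightarrow> (JK *v x) \<bullet> y = 0"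
    and W: "subspace W" and \<beta>: "\<beta> \<noteq> 0"
    and W_inactive: "\<And>r. r \<notin> S \<Longrightarrow> axis r 1 \<in> W"
    and range_inter: "range (\<lambda>v. selected_transpose H S *v v) \<inter> span N = {0}"
    and rank: "rank (selected_transpose H S) = card S"
    and x: "x = JD *v (x - \<alpha> *\<^sub>R (P *v x + transpose H *v u))"
    and u: "u = JK *v (u + \<beta> *\<^sub>R (H *v x))"
  shows "x = 0 \<and> u = 0"
proof -
  have u_orth: "u \<bullet> y = 0" if "y \<in> W" for y
    using JK_orth[OF that, of "u + \<beta> *\<^sub>R (H *v x)"] u by simp
  have supp: "u $ r = 0" if "r \<notin> S" for r
    using u_orth[OF W_inactive[OF that]] by (simp add: inner_axis)
  have "(u + \<beta> *\<^sub>R (H *v x)) - u \<in> W"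
    using JK_mem[of "u + \<beta> *\<^sub>R (H *v x)"] u by simp
  then have "\<beta> *\<^sub>R (H *v x) \<in> W" by simp
  then have "u \<bullet> (\<beta> *\<^sub>R (H *v x)) = 0" by (rule u_orth)
  then have uHx: "u \<bullet> (H *v x) = 0" using \<beta> by simp
  have "x \<bullet> (transpose H *v u) = u \<bullet> (H *v x)"
    by (metis dot_lmul_matrix inner_commute transpose_matrix_vector)
  then have xHu: "x \<bullet> (transpose H *v u) = 0" using uHx by simp
  have "x \<bullet> x \<le> x \<bullet> (x - \<alpha> *\<^sub>R (P *v x + transpose H *v u))"
    using JD_firm[of "x - \<alpha> *\<^sub>R (P *v x + transpose H *v u)"] x by simp
  then have "\<alpha> * (x \<bullet> (P *v x)) \<le> 0"
    using xHu by (simp add: inner_diff_right inner_add_right)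
  then have x0: "x = 0" using P[of x] \<alpha> by (auto simp: mult_le_0_iff)
  then have "JD *v (- \<alpha> *\<^sub>R (transpose H *v u)) = 0" using x by simp
  then have "- \<alpha> *\<^sub>R (transpose H *v u) \<in> span N" by (rule JD_kernel)
  then have "(- inverse \<alpha>) *\<^sub>R (- \<alpha> *\<^sub>R (transpose H *v u)) \<in> span N" by (rule span_scale)
  then have "transpose H *v u \<in> span N" using \<alpha> by simp
  then have "selected_transpose H S *v u \<in> span N" using selected_transpose_mult[OF supp] by metis
  then have "selected_transpose H S *v u = 0" using range_inter by blast
  then show ?thesis using full_column_rank_injective[OF rank supp] x0 by blast
qed

section \<open>The block Jacobian: smoothness and kernel equations\<close>

lemma ck_on_matrix_mult:
  fixes A :: "'a::real_normed_vector \<Rightarrow> real^'m::finite^'l::finite" and B :: "'a \<Rightarrow> real^'n::finite^'m"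
  assumes "open S" "ck_on k S A" "ck_on k S B"
  shows "ck_on k S (\<lambda>x. A x ** B x)"
  unfolding matrix_matrix_mult_def using assms
  by (intro ck_on_vec ck_on_sum ck_on_mult ck_on_nth)

lemma ck_on_block_matrix:
  fixes A :: "'a::real_normed_vector \<Rightarrow> real^'z::finite^'z" and D :: "'a \<Rightarrow> real^'w::finite^'w"
  assumes "open S" "ck_on k S A" "ck_on k S B" "ck_on k S C" "ck_on k S D"
  shows "ck_on k S (\<lambda>x. block_matrix (A x) (B x) (C x) (D x))"
proof -
  have "ck_on k S (\<lambda>x. case a of Inl r \<Rightarrow> (case b of Inl c \<Rightarrow> A x $ r $ c | Inr c \<Rightarrow> B x $ r $ c)
     | Inr r \<Rightarrow> (case b of Inl c \<Rightarrow> C x $ r $ c | Inr c \<Rightarrow> D x $ r $ c))" for a b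
    using assms by (cases a; cases b) (auto intro!: ck_on_nth)
  then show ?thesis
    unfolding block_matrix_def by (intro ck_on_vec assms(1))
qed

lemma block_matrix_mult:
  "block_matrix A B C D *v x = stack (A *v upper x + B *v lower x) (C *v upper x + D *v lower x)"
proof -
  have "(\<Sum>j\<in>UNIV. f j) = (\<Sum>j\<in>UNIV. f (Inl j)) + (\<Sum>j\<in>UNIV. f (Inr j))"
    for f :: "'a + 'b \<Rightarrow> real"
    by (simp add: UNIV_Plus_UNIV[symmetric] sum.Plus del: UNIV_Plus_UNIV)
  then show ?thesis
    by (auto simp: vec_eq_iff matrix_vector_mult_def block_matrix_def stack_def upper_def lower_def
        split: sum.split)
qed

lemma invertible_iff_kernel:
  fixes A :: "real^'n^'n::finite"
  assumes "\<And>x. A *v x = 0 \<Longrightarrow> x = 0"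
  shows "invertible A"
  using assms by (simp add: invertible_left_inverse matrix_left_invertible_ker)

lemma scaleR_uminus_matrix_vector:
  fixes A :: "real^'n::finite^'m::finite"
  shows "(- A) *v x = - (A *v x)"
  by (simp add: matrix_vector_mult_def vec_eq_iff sum_negf)

text \<open>The rows of the Jacobian are the linearized primal and dual steps. For a fixed vector of
  it the first row says that the new primal component equals the old one, so the extrapolation
  \<open>2 *\<^sub>R ?y - ?x\<close> in the second row collapses to \<open>?x\<close>.\<close>

lemma pipg_jacobian_mult:
  fixes P :: "real^'z::finite^'z" and H :: "real^'z^'w::finite"
  assumes JD_def: "JD = jacobian (closest_point D) (at (primal_arg \<alpha> P q H z w))"
    and JK_def: "JK = jacobian (closest_point Kpolar) (at (dual_arg \<alpha> \<beta> P q H g D z w))"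
    and zero: "(mat 1 - pipg_jacobian \<alpha> \<beta> P q H g D Kpolar z w) *v x = 0"
  shows "upper x = JD *v (upper x - \<alpha> *\<^sub>R (P *v upper x + transpose H *v lower x))"
    and "lower x = JK *v (lower x + \<beta> *\<^sub>R (H *v upper x))"
proof -
  let ?x = "upper x" and ?u = "lower x"
  let ?y = "JD *v (?x - \<alpha> *\<^sub>R (P *v ?x + transpose H *v ?u))"
  have "x = pipg_jacobian \<alpha> \<beta> P q H g D Kpolar z w *v x"
    using zero by (simp add: matrix_vector_mult_diff_rdistrib)
  then have "stack ?x ?u = stack
      ((JD ** (mat 1 - \<alpha> *\<^sub>R P)) *v ?x + (- (\<alpha> *\<^sub>R (JD ** transpose H))) *v ?u)
      ((\<beta> *\<^sub>R (JK ** H ** (- mat 1 + 2 *\<^sub>R (JD ** (mat 1 - \<alpha> *\<^sub>R P))))) *v ?x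
        + (JK - (2 * \<alpha> * \<beta>) *\<^sub>R (JK ** H ** JD ** transpose H)) *v ?u)"
    unfolding pipg_jacobian_def Let_def block_matrix_mult JD_def JK_def by simp
  then have 1: "?x = (JD ** (mat 1 - \<alpha> *\<^sub>R P)) *v ?x + (- (\<alpha> *\<^sub>R (JD ** transpose H))) *v ?u"
    and 2: "?u = (\<beta> *\<^sub>R (JK ** H ** (- mat 1 + 2 *\<^sub>R (JD ** (mat 1 - \<alpha> *\<^sub>R P))))) *v ?x
        + (JK - (2 * \<alpha> * \<beta>) *\<^sub>R (JK ** H ** JD ** transpose H)) *v ?u"
    unfolding stack_eq_iff by blast+
  note mv = matrix_vector_mul_assoc[symmetric] matrix_vector_mult_diff_rdistrib
    matrix_vector_mult_add_rdistrib scaleR_matrix_vector_assoc[symmetric] scaleR_uminus_matrix_vector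
    matrix_vector_mult_scaleR matrix_vector_right_distrib matrix_vector_mult_diff_distrib
  show x: "?x = ?y"
    using 1 by (simp add: mv algebra_simps)
  have "?u = JK *v (?u + \<beta> *\<^sub>R (H *v (2 *\<^sub>R ?y - ?x)))"
    using 2 by (simp add: mv algebra_simps)
  also have "2 *\<^sub>R ?y - ?x = ?x" unfolding x[symmetric] by (simp add: scaleR_2)
  finally show "?u = JK *v (?u + \<beta> *\<^sub>R (H *v ?x))" .
qed

section \<open>The three kinds of blocks and the data of the theorem\<close>

lemma block_cylinder_kinds:
  fixes zc :: "'z::finite \<Rightarrow> nat \<times> nat \<times> nat"
  assumes S: "S = block_set zc p \<Phi> i j" and conv: "convex S"
    and kind: "is_second_order_cone zc n i j S \<or> affine S \<or> smooth_independent_constraints zc p \<Phi> i j"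
  shows "convex (block_cylinder zc i j S)" and "closed (block_cylinder zc i j S)"
    and "x \<in> S \<Longrightarrow> v \<in> rel_interior (normal_cone (block_cylinder zc i j S) x) \<Longrightarrow>
      regular_projection (block_cylinder zc i j S) x v"
proof -
  let ?C = "block_cylinder zc i j S"
  show convC: "convex ?C"
    using convex_linear_vimage[OF linear_block_part conv] by (simp add: vimage_def)
  have mem: "x \<in> ?C" if "x \<in> S" for x
  proof -
    have "x \<in> block_space zc i j" using that S by (simp add: block_set_def)
    then have "block_part zc i j x = x"
      by (simp add: block_space_def block_part_nth vec_eq_iff)
    then show ?thesis using that by simp
  qed
  from kind consider "is_second_order_cone zc n i j S" | "affine S"
    | "smooth_independent_constraints zc p \<Phi> i j" by blast
  then have "closed ?C \<and> (\<forall>x v. x \<in> S \<longrightarrow> v \<in> rel_interior (normal_cone ?C x) \<longrightarrow>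
      regular_projection ?C x v)"
  proof cases
    case 1
    then obtain L e t where "cone_cylinder L e t ?C" by (rule cone_cylinder_block)
    then interpret cone_cylinder L e t ?C .
    show ?thesis using closed_C regular_projection_cone[OF mem] by blast
  next
    case 2
    then have "affine ?C" by (rule affine_block_cylinder)
    then show ?thesis
      using affine_closed[of ?C] regular_projection_affine[of ?C] mem by blast
  next
    case 3
    show ?thesis
      using block_cylinder_smooth_constraints[OF 3] convC unfolding S by simp
  qed
  then show "closed ?C" "x \<in> S \<Longrightarrow> v \<in> rel_interior (normal_cone ?C x) \<Longrightarrow> regular_projection ?C x v"
    by blast+
qed

lemma block_scalar_diag_positive:
  assumes "\<And>c. 0 < \<rho> (fst (zc c)) (fst (snd (zc c)))" and "x \<noteq> 0"
  shows "0 < x \<bullet> (block_scalar_diag zc \<rho> *v x)"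
proof -
  have eq: "(block_scalar_diag zc \<rho> *v x) $ c = \<rho> (fst (zc c)) (fst (snd (zc c))) * x $ c" for c
  proof -
    have "(block_scalar_diag zc \<rho> *v x) $ c
        = (\<Sum>d\<in>UNIV. if c = d then \<rho> (fst (zc c)) (fst (snd (zc c))) * x $ c else 0)"
      unfolding matrix_vector_mult_def block_scalar_diag_def vec_lambda_beta
      by (rule sum.cong) auto
    then show ?thesis by simp
  qed
  obtain c where c: "x $ c \<noteq> 0" using assms(2) by (auto simp: vec_eq_iff)
  have "0 < (\<Sum>c\<in>UNIV. \<rho> (fst (zc c)) (fst (snd (zc c))) * (x $ c)\<^sup>2)"
  proof (rule sum_pos2[of _ c])
    show "0 < \<rho> (fst (zc c)) (fst (snd (zc c))) * (x $ c)\<^sup>2"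
      using assms(1) c by (intro mult_pos_pos) auto
    show "0 \<le> \<rho> (fst (zc d)) (fst (snd (zc d))) * (x $ d)\<^sup>2" for d
      using assms(1)[of d] by simp
  qed auto
  then show ?thesis
    by (simp add: inner_vec_def eq power2_eq_square algebra_simps)
qed

lemma matrix_apply:
  fixes f :: "real^'n::finite \<Rightarrow> real^'m::finite"
  shows "linear f \<Longrightarrow> matrix f *v x = f x"
  by (simp add: matrix_works linear_matrix_vector_mul_eq)

lemma jacobian_apply:
  fixes f :: "real^'n::finite \<Rightarrow> real^'m::finite"
  assumes "(f has_derivative D) (at x)"
  shows "jacobian f (at x) *v h = D h"
  unfolding jacobian_def frechet_derivative_at[OF assms, symmetric]
  by (rule matrix_apply[OF has_derivative_linear[OF assms]])

theorem theorem3p13: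
  fixes N :: nat
    and m :: "nat \<Rightarrow> nat"
    and n p :: "nat \<Rightarrow> nat \<Rightarrow> nat"
    and nE nI :: "nat \<Rightarrow> nat"
    and zc :: "'z::finite \<Rightarrow> nat \<times> nat \<times> nat"
    and wc :: "'w::finite \<Rightarrow> nat \<times> nat"
    and \<rho> :: "nat \<Rightarrow> nat \<Rightarrow> real"
    and \<Phi> :: "nat \<Rightarrow> nat \<Rightarrow> nat \<Rightarrow> real^'z \<Rightarrow> real"
    and Dij :: "nat \<Rightarrow> nat \<Rightarrow> (real^'z) set"
    and P :: "real^'z^'z" and q :: "real^'z"
    and H :: "real^'z^'w" and g :: "real^'w"
    and D :: "(real^'z) set" and E :: "'w set" and K Kpolar :: "(real^'w) set"
    and \<alpha> \<beta> :: real
    and zs :: "real^'z" and ws :: "real^'w"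
  assumes z_labels: "bij_betw zc UNIV (z_positions N m n)"
    and w_labels: "bij_betw wc UNIV (w_positions N nE nI)"
    and rho_pos: "\<And>i j. i \<in> {0..N+1} \<Longrightarrow> j \<in> {1..m i} \<Longrightarrow> 0 < \<rho> i j"
    and P_eq: "P = block_scalar_diag zc \<rho>"
    and Dij_eq: "Dij = block_set zc p \<Phi>"
    and Dij_convex: "\<And>i j. i \<in> {0..N+1} \<Longrightarrow> j \<in> {1..m i} \<Longrightarrow> convex (Dij i j)"
    and D_eq: "D = product_set N m zc Dij"
    and D_nonempty: "D \<noteq> {}"
    and H_bidiagonal: "block_bidiagonal zc wc H"
    and E_eq: "E = eq_rows wc nE"
    and K_eq: "K = cone_K E"
    and Kpolar_eq: "Kpolar = polar_K E"
    and alpha_pos: "0 < \<alpha>"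
    and beta_pos: "0 < \<beta>"
    and fixed_point: "pipg \<alpha> \<beta> P q H g D Kpolar (zs, ws) = (zs, ws)"
    and solution: "qp_solution P q H g K D zs"
    and licq: "extended_LICQ D H g E zs"
    and Dij_kinds: "\<And>i j. i \<in> {0..N+1} \<Longrightarrow> j \<in> {1..m i} \<Longrightarrow>
          is_second_order_cone zc n i j (Dij i j) \<or> affine (Dij i j) \<or>
          smooth_independent_constraints zc p \<Phi> i j"
    and jacobian_symmetric: "\<And>x. closest_point D differentiable (at x) \<Longrightarrow>
          transpose (jacobian (closest_point D) (at x)) = jacobian (closest_point D) (at x)"
    and strict_compl_primal:
          "- (P *v zs + q + transpose H *v ws) \<in> rel_interior (normal_cone D zs)"
    and strict_compl_dual: "H *v zs - g \<in> rel_interior (normal_cone Kpolar ws)"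
  shows "\<exists>U. open U \<and> (zs, ws) \<in> U \<and>
    (\<forall>(z, w)\<in>U.
        closest_point D differentiable (at (primal_arg \<alpha> P q H z w)) \<and>
        closest_point Kpolar differentiable (at (dual_arg \<alpha> \<beta> P q H g D z w))) \<and>
    smooth_on U (\<lambda>(z, w). mat 1 - pipg_jacobian \<alpha> \<beta> P q H g D Kpolar z w) \<and>
    (\<forall>(z, w)\<in>U. invertible (mat 1 - pipg_jacobian \<alpha> \<beta> P q H g D Kpolar z w))"
proof -
  let ?I = "SIGMA i:{0..N+1}. {1..m i}"
  let ?Dk = "\<lambda>k. Dij (fst k) (snd k)"
  interpret orthogonal_blocks ?I "\<lambda>k. block_part zc (fst k) (snd k)"
    by (rule orthogonal_blocks_block_part[OF z_labels])
  have D_prod: "D = block_product ?Dk"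
    unfolding D_eq product_set_def block_product_def by auto
  have cyl: "cylinder ?Dk k = block_cylinder zc (fst k) (snd k) (?Dk k)" for k
    by (simp add: cylinder_def)
  have kinds: "convex (cylinder ?Dk k)" "closed (cylinder ?Dk k)"
    "x \<in> ?Dk k \<Longrightarrow> v \<in> rel_interior (normal_cone (cylinder ?Dk k) x) \<Longrightarrow>
      regular_projection (cylinder ?Dk k) x v" if "k \<in> ?I" for k x v
  proof -
    have k: "fst k \<in> {0..N+1}" "snd k \<in> {1..m (fst k)}" using that by auto
    have eq: "?Dk k = block_set zc p \<Phi> (fst k) (snd k)" by (simp add: Dij_eq)
    note * = block_cylinder_kinds[OF eq Dij_convex[OF k] Dij_kinds[OF k]]
    show "convex (cylinder ?Dk k)" "closed (cylinder ?Dk k)"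
      "x \<in> ?Dk k \<Longrightarrow> v \<in> rel_interior (normal_cone (cylinder ?Dk k) x) \<Longrightarrow>
        regular_projection (cylinder ?Dk k) x v"
      unfolding cyl using * by blast+
  qed
  have D: "convex D" "closed D"
    unfolding D_prod block_product_eq using kinds(1,2) by (auto intro!: convex_INT closed_INT simp del: atLeastAtMost_iff)
  have K: "convex Kpolar" "closed Kpolar"
    unfolding Kpolar_eq by (rule convex_polar_K closed_polar_K)+
  have Kne: "Kpolar \<noteq> {}"
    using rel_interior_subset strict_compl_dual unfolding Kpolar_eq polar_K_def by (auto intro!: exI[of _ 0])
  have fix1: "closest_point D (primal_arg \<alpha> P q H zs ws) = zs"
    and fix2: "closest_point Kpolar (dual_arg \<alpha> \<beta> P q H g D zs ws) = ws"
    using fixed_point by (auto simp: pipg_def primal_step_def)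
  have zs: "zs \<in> D" using closest_point_in_set[OF D(2) D_nonempty] fix1 by metis
  have ws: "ws \<in> Kpolar" using closest_point_in_set[OF K(2) Kne] fix2 by metis

  \<comment> \<open>Regularity of the primal projection at the fixed point\<close>
  let ?v = "\<alpha> *\<^sub>R (- (P *v zs + q + transpose H *v ws))"
  have v: "?v \<in> rel_interior (normal_cone D zs)"
    by (rule rel_interior_normal_cone_scale[OF strict_compl_primal alpha_pos])
  have primal0: "primal_arg \<alpha> P q H zs ws = zs + ?v"
    unfolding primal_arg_def scaleR_minus_right by simp
  have "regular_projection D zs ?v"
    unfolding D_prod
  proof (rule regular_projection_block_product)
    fix k assume k: "k \<in> ?I"
    let ?B = "block_part zc (fst k) (snd k)"
    have "?B zs \<in> ?Dk k" using zs k by (simp only: D_prod block_product_def mem_Collect_eq)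
    moreover have "?B ?v \<in> rel_interior (normal_cone (cylinder ?Dk k) (?B zs))"
      using rel_interior_normal_cone_cylinder[OF k] zs v unfolding D_prod by blast
    ultimately show "regular_projection (cylinder ?Dk k) (?B zs) (?B ?v)"
      by (rule kinds(3)[OF k])
  qed (use kinds zs in \<open>auto simp: D_prod simp del: atLeastAtMost_iff\<close>)
  then obtain VD where VD: "open VD" "zs + ?v \<in> VD" "smooth_on VD (closest_point D)"
    and D_kernel: "\<And>d. frechet_derivative (closest_point D) (at (zs + ?v)) d = 0 \<Longrightarrow>
        d \<in> span (normal_cone D zs)"
    unfolding regular_projection_def by blast

  \<comment> \<open>The dual projection near the fixed point\<close>
  let ?u = "\<beta> *\<^sub>R (H *v zs - g)"
  let ?W = "span (normal_cone Kpolar ws)"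
  have u: "?u \<in> rel_interior (normal_cone Kpolar ws)"
    by (rule rel_interior_normal_cone_scale[OF strict_compl_dual beta_pos])
  \<comment> \<open>At the fixed point the extrapolated point \<open>2 *\<^sub>R zs - zs\<close> is
    \<open>zs\<close> itself.\<close>
  have dual0: "dual_arg \<alpha> \<beta> P q H g D zs ws = ws + ?u"
    by (simp add: dual_arg_def primal_step_def fix1 scaleR_2)
  obtain e where e: "0 < e" "\<And>u. (\<And>v. v \<in> normal_cone Kpolar ws \<Longrightarrow> u \<bullet> v = 0) \<Longrightarrow> norm u < e \<Longrightarrow>
      ws + u \<in> Kpolar"
    using polar_K_flat ws unfolding Kpolar_eq by metis
  \<comment> \<open>The explicit map \<open>pr\<close> is kept instead of mere regularity: the
    kernel argument needs that the dual Jacobian is an orthogonal projector.\<close>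
  obtain VK pr where VK: "open VK" "ws + ?u \<in> VK" and pr: "linear pr"
    and cpK: "\<And>y. y \<in> VK \<Longrightarrow> closest_point Kpolar y = ws + pr (y - ws)"
    and pr_mem: "\<And>x. x - pr x \<in> ?W" and pr_orth: "\<And>x u. u \<in> ?W \<Longrightarrow> pr x \<bullet> u = 0"
    using projection_on_flat_face[OF K ws u e] by metis
  have bl_pr: "bounded_linear pr" using pr by (simp add: linear_conv_bounded_linear)
  have K_der: "(closest_point Kpolar has_derivative pr) (at y)" if "y \<in> VK" for y
  proof (rule has_derivative_transform_within_open[OF _ VK(1) that])
    show "((\<lambda>y. ws + pr (y - ws)) has_derivative pr) (at y)"
      by (rule derivative_eq_intros bounded_linear.has_derivative[OF bl_pr] refl)+ simp
  qed (simp add: cpK)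
  have K_jac: "jacobian (closest_point Kpolar) (at y) = matrix pr" if "y \<in> VK" for y
    unfolding jacobian_def using frechet_derivative_at[OF K_der[OF that]] by simp

  \<comment> \<open>The neighborhood and smoothness of the Jacobian\<close>
  define U1 where "U1 = {p. primal_arg \<alpha> P q H (fst p) (snd p) \<in> VD}"
  \<comment> \<open>The dual argument contains the primal projection, so it is known to be smooth
    only on \<open>U1\<close>; hence the nested sets.\<close>
  define U2 where "U2 = U1 \<inter> (\<lambda>p. dual_arg \<alpha> \<beta> P q H g D (fst p) (snd p)) -` VK"
  define J where "J p = mat 1 - pipg_jacobian \<alpha> \<beta> P q H g D Kpolar (fst p) (snd p)" for p
  define U where "U = U2 \<inter> (\<lambda>p. det (J p)) -` (- {0})"
  have fst_ck: "ck_on k S (fst :: (real^'z) \<times> (real^'w) \<Rightarrow> _)" if "open S" for k S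
    by (rule ck_on_linear[OF bounded_linear_fst that])
  have snd_ck: "ck_on k S (snd :: (real^'z) \<times> (real^'w) \<Rightarrow> _)" if "open S" for k S
    by (rule ck_on_linear[OF bounded_linear_snd that])
  note mult_ck = ck_on_bounded_linear[OF matrix_vector_mul_bounded_linear]
  have primal_ck: "ck_on k S (\<lambda>p. primal_arg \<alpha> P q H (fst p) (snd p))" if "open S" for k S
    unfolding primal_arg_def
    by (intro ck_on_diff ck_on_add ck_on_scaleR ck_on_const mult_ck fst_ck snd_ck that)
  have U1: "open U1"
  proof -
    have "continuous_on UNIV (\<lambda>p. primal_arg \<alpha> P q H (fst p) (snd p))"
      using primal_ck[OF open_UNIV, of 0] by simp
    from open_vimage[OF VD(1) this] show ?thesis by (simp add: U1_def vimage_def)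
  qed
  have dual_ck: "ck_on k U1 (\<lambda>p. dual_arg \<alpha> \<beta> P q H g D (fst p) (snd p))" for k
  proof -
    have "ck_on k U1 (\<lambda>p. primal_step \<alpha> P q H D (fst p) (snd p))"
      unfolding primal_step_def
      by (rule ck_on_compose[OF U1 _ primal_ck[OF U1] smooth_on_ck[OF VD(3)]]) (auto simp: U1_def)
    then show ?thesis
      unfolding dual_arg_def
      by (intro ck_on_diff ck_on_add ck_on_scaleR ck_on_const mult_ck fst_ck snd_ck U1)
  qed
  have U2: "open U2"
  proof -
    have "continuous_on U1 (\<lambda>p. dual_arg \<alpha> \<beta> P q H g D (fst p) (snd p))"
      using dual_ck[of 0] by simp
    from continuous_open_preimage[OF this U1 VK(1)] show ?thesis by (simp add: U2_def)
  qed
  have J_ck: "ck_on k U2 J" for k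
  proof -
    have "ck_on k U2 (\<lambda>p. jacobian (closest_point D) (at (primal_arg \<alpha> P q H (fst p) (snd p))))"
      by (rule ck_on_compose[OF U2 _ primal_ck[OF U2] smooth_on_ck[OF smooth_on_jacobian[OF VD(1,3)]]])
        (auto simp: U2_def U1_def)
    \<comment> \<open>On \<open>VK\<close> the dual projection is affine, so its Jacobian is the
      constant \<open>matrix pr\<close>.\<close>
    moreover have "ck_on k U2 (\<lambda>p. jacobian (closest_point Kpolar)
        (at (dual_arg \<alpha> \<beta> P q H g D (fst p) (snd p))))"
      by (rule ck_on_cong[OF ck_on_const[of k U2 "matrix pr"] U2]) (simp add: U2_def K_jac)
    ultimately show ?thesis
      unfolding J_def[abs_def] pipg_jacobian_def Let_def
      by (intro ck_on_diff ck_on_block_matrix ck_on_matrix_mult ck_on_add ck_on_scaleR ck_on_minus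
          ck_on_const U2)
  qed
  have U: "open U"
  proof -
    have "ck_on 0 U2 (\<lambda>p. det (J p))"
      by (intro ck_on_det ck_on_nth J_ck U2)
    then have "continuous_on U2 (\<lambda>p. det (J p))" by simp
    from continuous_open_preimage[OF this U2, of "- {0}"] show ?thesis by (simp add: U_def open_Compl)
  qed

  \<comment> \<open>Nonsingularity at the fixed point\<close>
  let ?S = "E \<union> {r. r \<notin> E \<and> (H *v zs) $ r = g $ r}"
  have licq1: "range (\<lambda>v. selected_transpose H ?S *v v) \<inter> span (normal_cone D zs) = {0}"
    and licq2: "rank (selected_transpose H ?S) = card ?S"
    using licq by (auto simp: extended_LICQ_def Let_def)
  \<comment> \<open>A nonzero residual in row \<open>r\<close> is a nonzero entry of a normal at
    \<open>ws\<close>, so slackness gives \<open>ws $ r = 0\<close> and the axis of that row is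
    itself a normal.\<close>
  have inactive: "axis r 1 \<in> ?W" if "r \<notin> ?S" for r
  proof -
    have r: "r \<notin> E" "(H *v zs - g) $ r \<noteq> 0" using that by auto
    have "ws $ r = 0"
      by (rule normal_cone_polar_K_inactive[OF _ _ r])
        (use ws strict_compl_dual rel_interior_subset Kpolar_eq in blast)+
    then show ?thesis
      unfolding Kpolar_eq by (intro span_base axis_in_normal_cone_polar_K r)
  qed
  have D_der: "(closest_point D has_derivative frechet_derivative (closest_point D) (at (zs + ?v)))
      (at (zs + ?v))"
    using smooth_on_differentiable[OF VD(3,2)] by (simp add: frechet_derivative_works)
  have P_pos: "0 < x \<bullet> (P *v x)" if "x \<noteq> 0" for x
    unfolding P_eq
  proof (rule block_scalar_diag_positive[OF _ that])
    fix c
    have "zc c \<in> z_positions N m n" using z_labels by (auto simp: bij_betw_def)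
    then show "0 < \<rho> (fst (zc c)) (fst (snd (zc c)))"
      by (auto simp: z_positions_def intro!: rho_pos)
  qed
  have "invertible (J (zs, ws))"
  proof (rule invertible_iff_kernel)
    fix x assume "J (zs, ws) *v x = 0"
    then have zero: "(mat 1 - pipg_jacobian \<alpha> \<beta> P q H g D Kpolar zs ws) *v x = 0" by (simp add: J_def)
    let ?JD = "jacobian (closest_point D) (at (zs + ?v))"
    have "upper x = 0 \<and> lower x = 0"
    proof (rule kernel_trivial_at_fixed_point[OF alpha_pos P_pos _ _ _ _ _ _ inactive licq1 licq2])
      show "upper x = ?JD *v (upper x - \<alpha> *\<^sub>R (P *v upper x + transpose H *v lower x))"
        by (rule pipg_jacobian_mult(1)[OF _ refl zero]) (simp only: primal0)
      show "lower x = matrix pr *v (lower x + \<beta> *\<^sub>R (H *v upper x))"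
        by (rule pipg_jacobian_mult(2)[OF refl _ zero]) (simp only: dual0 K_jac[OF VK(2)])
      show "(?JD *v d) \<bullet> (?JD *v d) \<le> (?JD *v d) \<bullet> d" for d
        unfolding jacobian_apply[OF D_der]
        by (rule closest_point_derivative_firm[OF D D_nonempty D_der])
      show "d \<in> span (normal_cone D zs)" if "?JD *v d = 0" for d
        using D_kernel that unfolding jacobian_apply[OF D_der] .
      show "y - matrix pr *v y \<in> ?W" for y
        unfolding matrix_apply[OF pr] by (rule pr_mem)
      show "(matrix pr *v y) \<bullet> w = 0" if "w \<in> ?W" for y w
        unfolding matrix_apply[OF pr] using that by (rule pr_orth)
    qed (use beta_pos in auto)
    then show "x = 0" by (metis stack_upper_lower stack_zero)
  qed
  then have "(zs, ws) \<in> U"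
    using VD(2) VK(2) by (simp add: U_def U2_def U1_def primal0 dual0 invertible_det_nz)
  moreover have "closest_point D differentiable (at (primal_arg \<alpha> P q H z w)) \<and>
      closest_point Kpolar differentiable (at (dual_arg \<alpha> \<beta> P q H g D z w))" if "(z, w) \<in> U" for z w
    using that smooth_on_differentiable[OF VD(3)] K_der
    by (auto simp: U_def U2_def U1_def differentiable_def)
  moreover have "smooth_on U (\<lambda>(z, w). mat 1 - pipg_jacobian \<alpha> \<beta> P q H g D Kpolar z w)"
  proof -
    have "smooth_on U J"
      unfolding smooth_on_def using ck_on_subset[OF J_ck] by (simp add: U_def)
    then show ?thesis by (simp add: J_def[abs_def] case_prod_unfold)
  qed
  moreover have "invertible (mat 1 - pipg_jacobian \<alpha> \<beta> P q H g D Kpolar z w)" if "(z, w) \<in> U" for z w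
    using that by (simp add: U_def J_def invertible_det_nz)
  ultimately show ?thesis using U by blast
qed

end
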